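(* Assume that: (A.1) $A$ is irreducible; (A.2) $X_M$ has a periodic point for $\sigma$; (A.3) $\varphi:X\to\mathbb{R}$ is summable and $[\varphi]_{k+1}<\infty$ for some fixed integer $k\ge1$. Let $\varphi(\epsilon,\cdot):X\to\mathbb{R}$, $\epsilon\in(0,1)$, be functions such that: (B.1) $\varphi(\epsilon,\cdot)\in F^1(X,\mathbb{R})$ for any $\epsilon>0$ and $\sup_{\epsilon>0}[\varphi(\epsilon,\cdot)]_{k+1}<\infty$; (B.2) $\sum_{s\in S}\exp(\sup_{\epsilon>0}\sup_{\omega\in[s]}\varphi(\epsilon,\omega))<\infty$; (B.3) with $\psi:X\to\mathbb{R}$ defined by $\psi(\omega)=\exp(\varphi(\omega))$ if $M(\omega_0\omega_1)=1$ and $\psi(\omega)=0$ otherwise, $\sup_{\omega\in[a]}|e^{\varphi(\epsilon,\omega)}-\psi(\omega)|\to0$ as $\epsilon\to0$ for each $a\in S$. Then $P(\varphi(\epsilon,\cdot))$ converges to $P(\varphi|_{X_M})$ as $\epsilon\to0$.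
   Context: Let $S$ be a countable set, $A=(A(ij))_{i,j\in S}$ a zero-one matrix, and $X=X_A=\{\omega=\omega_0\omega_1\cdots\in\prod_{n\ge0}S: A(\omega_i\omega_{i+1})=1 \text{ for all } i\ge 0\}$ with shift $(\sigma\omega)_n=\omega_{n+1}$. For $w\in S^n$, $[w]=\{\omega\in X:\omega_0\cdots\omega_{n-1}=w\}$. Fix $\theta\in(0,1)$ and the metric $d_\theta(\omega,\upsilon)=\theta^{\min\{n\ge0:\omega_n\ne\upsilon_n\}}$ for $\omega\ne\upsilon$. For a function $f$ on $X$, $\mathrm{var}_n f=\sup\{|f(\omega)-f(\upsilon)|:\omega_i=\upsilon_i,\ 0\le i\le n-1\}$ and $[f]_k=\sup_{n\ge k}\mathrm{var}_nf/\theta^n$. $F^1(X,\mathbb{R})$ is the set of continuous $f:X\to\mathbb{R}$ with $[f]_1<\infty$. $S_0\subset S$ is nonempty and $M=(M(ij))_{i,j\in S_0}$ is a zero-one matrix with $M(ij)\le A(ij)$; put $M(ij)=0$ if $i\notin S_0$ or $j\notin S_0$. $X_M=\{\omega\in\prod_{n\ge0}S_0: M(\omega_n\omega_{n+1})=1\ \forall n\ge0\}\subset X$. $A$ is irreducible if for all $a,b\in S$ there are $n\ge1$ and a word $w_1\cdots w_{n+1}$ with $w_1=a$, $w_{n+1}=b$ and $A(w_iw_{i+1})=1$ for $1\le i\le n$. A function $\varphi:X\to\mathbb{R}$ is summable if $\sum_{s\in S:[s]\ne\emptyset}\exp(\sup_{[s]}\varphi)<\infty$. With $S_n\varphi=\sum_{i=0}^{n-1}\varphi\circ\sigma^i$,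 the topological pressure is $P(\varphi)=\lim_{n\to\infty}\frac1n\log\sum_{w\in S^n:[w]\neq\emptyset}\exp(\sup_{[w]}S_n\varphi)$, and $P(\varphi|_{X_M})$ is defined in the same way with $[w]$ replaced by $[w]\cap X_M$. *)

theory Defs
  imports "HOL-Analysis.Analysis"
begin

type_synonym 'a sequence = "nat \<Rightarrow> 'a"

definition markov_shift :: "'a set \<Rightarrow> ('a \<Rightarrow> 'a \<Rightarrow> nat) \<Rightarrow> 'a sequence set" where
  "markov_shift S A = {\<omega>. (\<forall>n. \<omega> n \<in> S) \<and> (\<forall>n. A (\<omega> n) (\<omega> (Suc n)) = 1)}"

definition zero_one_matrix :: "'a set \<Rightarrow> ('a \<Rightarrow> 'a \<Rightarrow> nat) \<Rightarrow> bool" where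
  "zero_one_matrix S A \<longleftrightarrow> (\<forall>i\<in>S. \<forall>j\<in>S. A i j \<in> {0, 1})"

definition irreducible_matrix :: "'a set \<Rightarrow> ('a \<Rightarrow> 'a \<Rightarrow> nat) \<Rightarrow> bool" where
  "irreducible_matrix S A \<longleftrightarrow>
     (\<forall>a\<in>S. \<forall>b\<in>S. \<exists>n\<ge>1. \<exists>w. length w = n + 1 \<and> set w \<subseteq> S \<and>
        w ! 0 = a \<and> w ! n = b \<and> (\<forall>i<n. A (w ! i) (w ! (i + 1)) = 1))"

definition shift :: "'a sequence \<Rightarrow> 'a sequence" where
  "shift \<omega> = (\<lambda>n. \<omega> (Suc n))"

definition has_periodic_point :: "'a sequence set \<Rightarrow> bool" where
  "has_periodic_point Y \<longleftrightarrow> (\<exists>\<omega>\<in>Y. \<exists>p\<ge>1. (shift ^^ p) \<omega> = \<omega>)"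

definition words :: "'a set \<Rightarrow> nat \<Rightarrow> 'a list set" where
  "words S n = {w. length w = n \<and> set w \<subseteq> S}"

(* For Y \<subseteq> X, cyl Y w is the intersection of the cylinder of w in X with Y. *)
definition cyl :: "'a sequence set \<Rightarrow> 'a list \<Rightarrow> 'a sequence set" where
  "cyl Y w = {\<omega> \<in> Y. \<forall>i<length w. \<omega> i = w ! i}"

definition dist_theta :: "real \<Rightarrow> 'a sequence \<Rightarrow> 'a sequence \<Rightarrow> real" where
  "dist_theta \<theta> \<omega> \<upsilon> = (if \<omega> = \<upsilon> then 0 else \<theta> ^ (LEAST n. \<omega> n \<noteq> \<upsilon> n))"

lemma dist_theta_le_iff_agree:
  assumes "0 < \<theta>" "\<theta> < 1"
  shows "dist_theta \<theta> \<omega> \<upsilon> \<le> \<theta> ^ n \<longleftrightarrow> (\<forall>i<n. \<omega> i = \<upsilon> i)"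
proof (cases "\<omega> = \<upsilon>")
  case True
  then show ?thesis using assms by (simp add: dist_theta_def)
next
  case False
  then obtain m where m: "\<omega> m \<noteq> \<upsilon> m" by blast
  let ?l = "LEAST n. \<omega> n \<noteq> \<upsilon> n"
  have "\<omega> ?l \<noteq> \<upsilon> ?l" by (rule LeastI[of _ m]) (rule m)
  moreover have "\<And>i. i < ?l \<Longrightarrow> \<omega> i = \<upsilon> i" using not_less_Least by blast
  ultimately have "(\<forall>i<n. \<omega> i = \<upsilon> i) \<longleftrightarrow> n \<le> ?l"
    by (meson leI less_le_trans)
  moreover have "\<theta> ^ ?l \<le> \<theta> ^ n \<longleftrightarrow> n \<le> ?l"
    using assms by (simp add: power_decreasing_iff)
  ultimately show ?thesis using False by (simp add: dist_theta_def)
qed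

lemma Metric_space_dist_theta:
  assumes "0 < \<theta>" "\<theta> < 1"
  shows "Metric_space X (dist_theta \<theta>)"
proof
  fix x y z :: "'a sequence"
  show nonneg: "0 \<le> dist_theta \<theta> x y" for x y :: "'a sequence"
    using assms by (simp add: dist_theta_def)
  show "dist_theta \<theta> x y = dist_theta \<theta> y x"
    by (auto simp: dist_theta_def eq_commute)
  show "dist_theta \<theta> x y = 0 \<longleftrightarrow> x = y"
    using assms by (simp add: dist_theta_def)
  show "dist_theta \<theta> x z \<le> dist_theta \<theta> x y + dist_theta \<theta> y z"
  proof (cases "x = y \<or> y = z")
    case True
    then show ?thesis using nonneg by (auto simp: dist_theta_def)
  next
    case False
    then obtain m n where m: "dist_theta \<theta> x y = \<theta> ^ m" and n: "dist_theta \<theta> y z = \<theta> ^ n"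
      by (auto simp: dist_theta_def)
    have "\<forall>i<m. x i = y i" "\<forall>i<n. y i = z i"
      using dist_theta_le_iff_agree[OF assms] m n by (metis order_refl)+
    then have "\<forall>i<min m n. x i = z i" by simp
    then have "dist_theta \<theta> x z \<le> \<theta> ^ min m n"
      using dist_theta_le_iff_agree[OF assms] by blast
    also have "\<dots> \<le> \<theta> ^ m + \<theta> ^ n" using assms by (simp add: min_def)
    finally show ?thesis using m n by simp
  qed
qed

definition var :: "'a sequence set \<Rightarrow> nat \<Rightarrow> ('a sequence \<Rightarrow> real) \<Rightarrow> ennreal" where
  "var X n f = (SUP (\<omega>, \<upsilon>) \<in> {(\<omega>, \<upsilon>). \<omega> \<in> X \<and> \<upsilon> \<in> X \<and> (\<forall>i<n. \<omega> i = \<upsilon> i)}. ennreal \<bar>f \<omega> - f \<upsilon>\<bar>)"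

definition lip_seminorm :: "real \<Rightarrow> 'a sequence set \<Rightarrow> nat \<Rightarrow> ('a sequence \<Rightarrow> real) \<Rightarrow> ennreal" where
  "lip_seminorm \<theta> X k f = (SUP n\<in>{k..}. var X n f / ennreal (\<theta> ^ n))"

(* Functions on X are total functions on sequences, of which only the values on X matter. *)
definition F1 :: "real \<Rightarrow> 'a sequence set \<Rightarrow> ('a sequence \<Rightarrow> real) set" where
  "F1 \<theta> X = {f. continuous_map (Metric_space.mtopology X (dist_theta \<theta>)) euclideanreal f
              \<and> lip_seminorm \<theta> X 1 f < \<infinity>}"

(* exp and ln with exp(-\<infinity>) = 0, exp \<infinity> = \<infinity>, ln 0 = -\<infinity>, ln \<infinity> = \<infinity>; suprema of functions that
   are not known to be bounded above are taken in ereal. *)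
definition ereal_exp :: "ereal \<Rightarrow> ennreal" where
  "ereal_exp x = (if x = \<infinity> then \<infinity> else if x = -\<infinity> then 0 else ennreal (exp (real_of_ereal x)))"

definition ennreal_ln :: "ennreal \<Rightarrow> ereal" where
  "ennreal_ln z = (if z = \<infinity> then \<infinity> else if z = 0 then -\<infinity> else ereal (ln (enn2real z)))"

definition summable_potential :: "'a set \<Rightarrow> 'a sequence set \<Rightarrow> ('a sequence \<Rightarrow> real) \<Rightarrow> bool" where
  "summable_potential S X \<phi> \<longleftrightarrow>
     (\<Sum>\<^sub>\<infinity>s\<in>{s \<in> S. cyl X [s] \<noteq> {}}. ereal_exp (SUP \<omega>\<in>cyl X [s]. ereal (\<phi> \<omega>))) < \<infinity>"

definition birkhoff_sum :: "nat \<Rightarrow> ('a sequence \<Rightarrow> real) \<Rightarrow> 'a sequence \<Rightarrow> real" where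
  "birkhoff_sum n \<phi> \<omega> = (\<Sum>i<n. \<phi> ((shift ^^ i) \<omega>))"

definition partition_fun :: "'a set \<Rightarrow> 'a sequence set \<Rightarrow> ('a sequence \<Rightarrow> real) \<Rightarrow> nat \<Rightarrow> ennreal" where
  "partition_fun S Y \<phi> n =
     (\<Sum>\<^sub>\<infinity>w\<in>{w \<in> words S n. cyl Y w \<noteq> {}}. ereal_exp (SUP \<omega>\<in>cyl Y w. ereal (birkhoff_sum n \<phi> \<omega>)))"

(* Topological pressure of the restriction of \<phi> to the shift-invariant set Y. The limit exists, by
   submultiplicativity of the partition functions, as soon as the first one is finite. *)
definition pressure :: "'a set \<Rightarrow> 'a sequence set \<Rightarrow> ('a sequence \<Rightarrow> real) \<Rightarrow> ereal" where
  "pressure S Y \<phi> = lim (\<lambda>n. ereal (1 / real n) * ennreal_ln (partition_fun S Y \<phi> n))"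

end

(* Weight a word of k-blocks by the supremum over its cylinder of the product of psi along the orbit;
   k-blocks are needed because var_n phi may be infinite for n <= k. Outside a finite set
   of blocks the total weight of the blocks is arbitrarily small, and cutting a word at the first and
   last visits to the finitely many remaining blocks shows that the exponential growth rate of the
   partition functions of the degenerate weight psi is attained by loops at a single block. A loop of
   positive weight follows M, so concatenations of finitely many loops lie in X_M; since the weights
   of finitely many words depend continuously on the parameter and [phi]_{k+1} < oo bounds the
   distortion, loops bound both pressures from below. If no block has loops of rate r, some partition
   function of psi is below exp(n r), and dominated convergence carries this over to small epsilon. *)
theory Submission
  imports Defs
begin

text \<open>The two pressures are never compared directly. For \<rho>' < \<rho> one test that does
  not involve \<epsilon>, the convergence of the loop series of the limit weight, decides whether
  for small \<epsilon> both pressures are at most \<rho> or both are at least \<rho>'; the limit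
  follows since the gap is arbitrary. One obstacle is that the suprema of the limit weight run over
  cylinders of X. A word of positive weight follows M but may have no continuation inside X_M, so
  these partition functions can exceed those of X_M at every length. Loops can be repeated for ever,
  and so they are visible in X_M as well. The other obstacle is the exchange of the limits in n and
  \<epsilon>. Both bounds avoid it by using data of one fixed length: the pressure is an infimum
  over n, so one length bounds it from above, and a finite family of loops of one length bounds it
  from below.\<close>

section \<open>Sums in the extended nonnegative reals\<close>

(* The library fact summable_on_ennreal covers only the image of extended naturals: a coercion was
   inserted into its statement. *)
lemma ennreal_summable_on: "f summable_on A" for f :: "'b \<Rightarrow> ennreal"
  by (rule nonneg_summable_on_complete) simp

lemma infsum_ennreal_eq_SUP:
  fixes f :: "'b \<Rightarrow> ennreal"
  shows "infsum f A = (SUP F\<in>{F. finite F \<and> F \<subseteq> A}. sum f F)"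
  by (rule nonneg_infsum_complete) simp

lemma infsum_ennreal_le_iff:
  fixes f :: "'b \<Rightarrow> ennreal"
  shows "infsum f A \<le> c \<longleftrightarrow> (\<forall>F. finite F \<longrightarrow> F \<subseteq> A \<longrightarrow> sum f F \<le> c)"
  unfolding infsum_ennreal_eq_SUP by (auto simp: SUP_le_iff)

lemma sum_le_infsum_ennreal:
  fixes f :: "'b \<Rightarrow> ennreal"
  assumes "finite F" "F \<subseteq> A"
  shows "sum f F \<le> infsum f A"
  using infsum_ennreal_le_iff[of f A "infsum f A"] assms by blast

lemma infsum_ennreal_mono:
  fixes f g :: "'b \<Rightarrow> ennreal"
  assumes "\<And>x. x \<in> A \<Longrightarrow> f x \<le> g x"
  shows "infsum f A \<le> infsum g A"
  using assms by (intro infsum_mono ennreal_summable_on) auto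

lemma infsum_ennreal_mono_set:
  fixes f :: "'b \<Rightarrow> ennreal"
  assumes "A \<subseteq> B"
  shows "infsum f A \<le> infsum f B"
  using assms by (intro infsum_mono_neutral ennreal_summable_on) auto

lemma infsum_ennreal_Un_le:
  fixes f :: "'b \<Rightarrow> ennreal"
  shows "infsum f (A \<union> B) \<le> infsum f A + infsum f B"
proof -
  have "infsum f (A \<union> B) = infsum f (A \<union> (B - A))" by simp
  also have "\<dots> = infsum f A + infsum f (B - A)"
    by (intro infsum_Un_disjoint ennreal_summable_on) auto
  also have "\<dots> \<le> infsum f A + infsum f B"
    by (intro add_left_mono infsum_ennreal_mono_set) auto
  finally show ?thesis .
qed

lemma infsum_ennreal_cmult:
  fixes f :: "'b \<Rightarrow> ennreal"
  shows "infsum (\<lambda>x. c * f x) A = c * infsum f A"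
  unfolding infsum_ennreal_eq_SUP sum_distrib_left[symmetric]
  by (subst SUP_mult_left_ennreal) auto

lemma infsum_ennreal_image_le:
  fixes f :: "'b \<Rightarrow> ennreal"
  shows "infsum f (g ` A) \<le> infsum (\<lambda>x. f (g x)) A"
proof -
  obtain B where "B \<subseteq> A" "inj_on g B" "g ` A = g ` B"
    by (metis subset_image_inj subset_refl)
  then show ?thesis
    by (simp add: infsum_reindex o_def infsum_ennreal_mono_set)
qed

lemma infsum_ennreal_Times_le:
  fixes f :: "'b \<Rightarrow> ennreal" and g :: "'c \<Rightarrow> ennreal"
  shows "infsum (\<lambda>(x, y). f x * g y) (A \<times> B) \<le> infsum f A * infsum g B"
  unfolding infsum_ennreal_le_iff
proof (intro allI impI)
  fix F assume F: "finite F" "F \<subseteq> A \<times> B"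
  have "(\<Sum>(x, y)\<in>F. f x * g y) \<le> (\<Sum>(x, y)\<in>fst ` F \<times> snd ` F. f x * g y)"
    using F by (intro sum_mono2) force+
  also have "\<dots> = sum f (fst ` F) * sum g (snd ` F)"
    by (simp add: sum.cartesian_product sum_product)
  also have "\<dots> \<le> infsum f A * infsum g B"
    using F by (intro mult_mono sum_le_infsum_ennreal) auto
  finally show "(\<Sum>(x, y)\<in>F. f x * g y) \<le> infsum f A * infsum g B" .
qed

text \<open>A word may be assembled from pieces in several ways; for an upper bound one of them
  suffices, so \<open>h\<close> may fail to be injective.\<close>

lemma infsum_ennreal_image_Times_le:
  fixes f :: "'d \<Rightarrow> ennreal"
  assumes "\<And>x y. x \<in> A \<Longrightarrow> y \<in> B \<Longrightarrow> f (h x y) \<le> g x * g' y"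
  shows "infsum f ((\<lambda>(x, y). h x y) ` (A \<times> B)) \<le> infsum g A * infsum g' B"
proof -
  have "infsum f ((\<lambda>(x, y). h x y) ` (A \<times> B)) \<le> infsum (\<lambda>z. f (case z of (x, y) \<Rightarrow> h x y)) (A \<times> B)"
    by (rule infsum_ennreal_image_le)
  also have "\<dots> \<le> infsum (\<lambda>(x, y). g x * g' y) (A \<times> B)"
    using assms by (intro infsum_ennreal_mono) auto
  also have "\<dots> \<le> infsum g A * infsum g' B"
    by (rule infsum_ennreal_Times_le)
  finally show ?thesis .
qed

lemma infsum_ennreal_tail:
  fixes f :: "'b \<Rightarrow> ennreal"
  assumes "infsum f A < \<infinity>" "0 < e"
  obtains F where "finite F" "F \<subseteq> A" "infsum f (A - F) < e"
proof -
  \<comment> \<open>\<open>e\<close> may be infinite, so it is capped to give a finite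
    tolerance.\<close>
  define d where "d = min e 1"
  have d: "0 < d" "d < \<infinity>" "d \<le> e"
    using assms by (auto simp: d_def min_def intro: le_less_trans[OF _ ennreal_one_less_top])
  have "infsum f A < infsum f A + d"
    using assms d ennreal_add_left_cancel_less[of "infsum f A" 0 d] by simp
  also have "\<dots> = (SUP F\<in>{F. finite F \<and> F \<subseteq> A}. sum f F + d)"
    unfolding infsum_ennreal_eq_SUP using d by (subst ennreal_SUP_add_left) auto
  finally obtain F where F: "finite F" "F \<subseteq> A" "infsum f A < sum f F + d"
    by (auto simp: less_SUP_iff)
  have "infsum f A = sum f F + infsum f (A - F)"
    using infsum_Un_disjoint[of f F "A - F"] F by (auto simp: Un_absorb1 ennreal_summable_on)
  with F(3) have "infsum f (A - F) < d"
    by (simp add: ennreal_add_left_cancel_less)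
  then show ?thesis
    using F d by (intro that[of F]) auto
qed

section \<open>Words and loops\<close>

lemma infsum_ennreal_le_suminf_fibers:
  fixes f :: "'b \<Rightarrow> ennreal" and h :: "'b \<Rightarrow> nat"
  assumes "\<And>q. infsum f {x \<in> A. h x = q} \<le> c q"
  shows "infsum f A \<le> (\<Sum>q. c q)"
  unfolding infsum_ennreal_le_iff
proof (intro allI impI)
  fix F assume F: "finite F" "F \<subseteq> A"
  obtain Q where Q: "h ` F \<subseteq> {..<Q}"
    using F finite_nat_bounded by blast
  have "sum f F = (\<Sum>q<Q. sum f {x \<in> F. h x = q})"
    using F Q by (subst sum.group) auto
  also have "\<dots> \<le> (\<Sum>q<Q. infsum f {x \<in> A. h x = q})"
    using F by (intro sum_mono sum_le_infsum_ennreal) auto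
  also have "\<dots> \<le> (\<Sum>q<Q. c q)"
    by (intro sum_mono assms)
  also have "\<dots> \<le> (\<Sum>q. c q)"
    by (intro sum_le_suminf) auto
  finally show "sum f F \<le> (\<Sum>q. c q)" .
qed

text \<open>If every fiber with q \<ge> 1 had sum at least 1, the first Q of them would force the
  total to be at least Q. For words, with \<open>h\<close> the length, this turns convergence of the
  whole series into a strict inequality at one positive length.\<close>

lemma infsum_ennreal_small_fiber:
  fixes f :: "'b \<Rightarrow> ennreal" and h :: "'b \<Rightarrow> nat"
  assumes "infsum f A < \<infinity>"
  shows "\<exists>q\<ge>1. infsum f {x \<in> A. h x = q} < 1"
proof (rule ccontr)
  assume "\<not> ?thesis"
  then have ge1: "infsum f {x \<in> A. h x = q} \<ge> 1" if "q \<ge> 1" for q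
    using that not_le by blast
  have "of_nat Q \<le> infsum f {x \<in> A. 1 \<le> h x \<and> h x \<le> Q}" for Q
  proof (induction Q)
    case (Suc Q)
    have "{x \<in> A. 1 \<le> h x \<and> h x \<le> Suc Q}
        = {x \<in> A. 1 \<le> h x \<and> h x \<le> Q} \<union> {x \<in> A. h x = Suc Q}"
      by auto
    then have "infsum f {x \<in> A. 1 \<le> h x \<and> h x \<le> Suc Q}
        = infsum f {x \<in> A. 1 \<le> h x \<and> h x \<le> Q} + infsum f {x \<in> A. h x = Suc Q}"
      by (simp only:) (rule infsum_Un_disjoint; auto simp: ennreal_summable_on)
    with add_mono[OF Suc ge1[of "Suc Q"]] show ?case
      by (simp add: add.commute)
  qed simp
  then have "of_nat Q \<le> infsum f A" for Q
    by (rule order_trans) (auto intro: infsum_ennreal_mono_set)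
  moreover obtain Q :: nat where "infsum f A < of_nat Q"
    using assms ennreal_Ex_less_of_nat by auto
  ultimately show False
    using not_le by blast
qed

lemma words_0: "words B 0 = {[]}"
  by (auto simp: words_def)

lemma words_Suc: "words B (Suc n) = (\<lambda>(x, xs). x # xs) ` (B \<times> words B n)"
  by (auto simp: words_def length_Suc_conv image_iff)

lemma words_add: "words B (m + n) = (\<lambda>(u, v). u @ v) ` (words B m \<times> words B n)"
proof
  show "words B (m + n) \<subseteq> (\<lambda>(u, v). u @ v) ` (words B m \<times> words B n)"
  proof
    fix w assume "w \<in> words B (m + n)"
    then have "(take m w, drop m w) \<in> words B m \<times> words B n"
      by (auto simp: words_def dest: in_set_takeD in_set_dropD)
    then show "w \<in> (\<lambda>(u, v). u @ v) ` (words B m \<times> words B n)"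
      by (intro image_eqI[of _ _ "(take m w, drop m w)"]) auto
  qed
qed (auto simp: words_def)

lemma words_eq_lists: "words B n = {w \<in> lists B. length w = n}"
  by (auto simp: words_def)

lemma infsum_words_le_power:
  fixes f :: "'b list \<Rightarrow> ennreal"
  assumes f_Nil: "f [] \<le> 1" and f_append: "\<And>u v. f (u @ v) \<le> f u * f v"
  shows "infsum f (words D q) \<le> (infsum (\<lambda>b. f [b]) D) ^ q"
proof (induction q)
  case 0
  then show ?case using f_Nil by (simp add: words_0)
next
  case (Suc q)
  have "infsum f (words D (Suc q)) \<le> infsum (\<lambda>b. f [b]) D * infsum f (words D q)"
    unfolding words_Suc using f_append[of "[_]"] by (intro infsum_ennreal_image_Times_le) simp
  also have "\<dots> \<le> infsum (\<lambda>b. f [b]) D * (infsum (\<lambda>b. f [b]) D) ^ q"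
    by (intro mult_left_mono Suc) simp
  finally show ?case by simp
qed

text \<open>\<open>l\<close> runs from the first occurrence of \<open>b\<close> up to, but
  excluding, the last one, so it is empty when \<open>b\<close> occurs once. The excluded
  \<open>b\<close> is where the loop closes.\<close>

lemma split_list_first_last:
  assumes "b \<in> set w"
  obtains u l v where "w = u @ l @ b # v" "b \<notin> set u" "b \<notin> set v" "l = [] \<or> hd l = b"
proof -
  obtain u w' where u: "w = u @ b # w'" "b \<notin> set u"
    using split_list_first[OF assms] by blast
  obtain l v where l: "b # w' = l @ b # v" "b \<notin> set v"
    using split_list_last[of b "b # w'"] by auto
  have "l = [] \<or> hd l = b"
    using l(1) by (cases l) auto
  with u l show ?thesis
    by (intro that[of u l v]) auto
qed

(* The letters outside a finite set F contribute a convergent geometric series. The letters of F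
   are then added one at a time: a word containing b splits at the first and the last occurrence
   of b into two words avoiding b and a loop at b. *)
lemma infsum_lists_finite_if_loops_finite:
  fixes f :: "'b list \<Rightarrow> ennreal" and g :: "'b list \<Rightarrow> 'b \<Rightarrow> ennreal"
  assumes f_Nil: "f [] \<le> 1" and f_append: "\<And>u v. f (u @ v) \<le> f u * f v"
    and f_loop: "\<And>l b v. f (l @ b # v) \<le> g l b * f (b # v)"
    and letters: "infsum (\<lambda>b. f [b]) B < \<infinity>"
    and loops: "\<And>b. b \<in> B \<Longrightarrow> infsum (\<lambda>l. g l b) {l \<in> lists B. l = [] \<or> hd l = b} < \<infinity>"
  shows "infsum f (lists B) < \<infinity>"
proof -
  \<comment> \<open>Any number below 1 would do for 1/2: it becomes the ratio of the geometric
    series over words with all letters outside \<open>F\<close>.\<close>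
  have "0 < ennreal (1 / 2)"
    by (subst ennreal_less_zero_iff) simp
  then obtain F where F: "finite F" "F \<subseteq> B" "infsum (\<lambda>b. f [b]) (B - F) < ennreal (1 / 2)"
    by (rule infsum_ennreal_tail[OF letters])
  have "infsum f (lists ((B - F) \<union> E)) < \<infinity>" if "finite E" "E \<subseteq> F" for E
    using that
  proof (induction E)
    case empty
    have "infsum f {w \<in> lists (B - F). length w = q} \<le> ennreal ((1 / 2) ^ q)" for q
    proof -
      have "infsum f {w \<in> lists (B - F). length w = q} \<le> (infsum (\<lambda>b. f [b]) (B - F)) ^ q"
        unfolding words_eq_lists[symmetric] using f_Nil f_append by (rule infsum_words_le_power)
      also have "\<dots> \<le> ennreal (1 / 2) ^ q"
        using F(3) by (intro power_mono) auto
      also have "\<dots> = ennreal ((1 / 2) ^ q)"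
        by (rule ennreal_power) simp
      finally show ?thesis .
    qed
    then have "infsum f (lists (B - F)) \<le> (\<Sum>q. ennreal ((1 / 2) ^ q))"
      by (rule infsum_ennreal_le_suminf_fibers)
    also have "\<dots> = ennreal (\<Sum>q. (1 / 2) ^ q)"
      by (intro suminf_ennreal2 summable_geometric) auto
    finally show ?case
      by (simp add: le_less_trans[OF _ ennreal_less_top])
  next
    case (insert b E)
    define D where "D = (B - F) \<union> E"
    define \<Lambda> where "\<Lambda> = {l \<in> lists B. l = [] \<or> hd l = b}"
    have "b \<in> B" "D \<subseteq> B" and fin: "infsum f (lists D) < \<infinity>"
      using insert F by (auto simp: D_def)
    let ?h = "\<lambda>(u, z). case z of (l, v) \<Rightarrow> u @ l @ b # v"
    have "lists (insert b D) \<subseteq> lists D \<union> ?h ` (lists D \<times> \<Lambda> \<times> lists D)"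
    proof
      fix w assume w: "w \<in> lists (insert b D)"
      show "w \<in> lists D \<union> ?h ` (lists D \<times> \<Lambda> \<times> lists D)"
      proof (cases "b \<in> set w")
        case True
        then obtain u l v where "w = u @ l @ b # v" "b \<notin> set u" "b \<notin> set v" "l = [] \<or> hd l = b"
          by (rule split_list_first_last)
        with w \<open>D \<subseteq> B\<close> \<open>b \<in> B\<close> have "(u, l, v) \<in> lists D \<times> \<Lambda> \<times> lists D"
          by (auto simp: \<Lambda>_def)
        with \<open>w = _\<close> show ?thesis
          by (intro UnI2 image_eqI[of _ _ "(u, l, v)"]) auto
      qed (use w in auto)
    qed
    then have "infsum f (lists (insert b D)) \<le> infsum f (lists D \<union> ?h ` (lists D \<times> \<Lambda> \<times> lists D))"
      by (rule infsum_ennreal_mono_set)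
    also have "\<dots> \<le> infsum f (lists D) + infsum f (?h ` (lists D \<times> \<Lambda> \<times> lists D))"
      by (rule infsum_ennreal_Un_le)
    also have "infsum f (?h ` (lists D \<times> \<Lambda> \<times> lists D))
      \<le> infsum f (lists D) * infsum (\<lambda>(l, v). g l b * (f [b] * f v)) (\<Lambda> \<times> lists D)"
    proof (rule infsum_ennreal_image_Times_le, clarify)
      fix u l v
      have "f (u @ l @ b # v) \<le> f u * f (l @ b # v)"
        by (rule f_append)
      \<comment> \<open>\<open>f_loop\<close> in place of \<open>f_append\<close>: the weight
        \<open>g l b\<close> remembers that the loop is followed by \<open>b\<close>.\<close>
      also have "\<dots> \<le> f u * (g l b * f ([b] @ v))"
        using f_loop[of l b v] by (intro mult_left_mono) auto
      also have "\<dots> \<le> f u * (g l b * (f [b] * f v))"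
        by (intro mult_left_mono f_append) auto
      finally show "f (u @ l @ b # v) \<le> f u * (g l b * (f [b] * f v))" .
    qed
    also have "infsum (\<lambda>(l, v). g l b * (f [b] * f v)) (\<Lambda> \<times> lists D)
      \<le> infsum (\<lambda>l. g l b) \<Lambda> * infsum (\<lambda>v. f [b] * f v) (lists D)"
      by (rule infsum_ennreal_Times_le)
    also have "infsum (\<lambda>v. f [b] * f v) (lists D) = f [b] * infsum f (lists D)"
      by (rule infsum_ennreal_cmult)
    finally have "infsum f (lists (insert b D)) \<le>
        infsum f (lists D) + infsum f (lists D) * (infsum (\<lambda>l. g l b) \<Lambda> * (f [b] * infsum f (lists D)))"
      by (simp add: add_left_mono mult_left_mono)
    moreover have "f [b] < \<infinity>"
      using sum_le_infsum_ennreal[of "{b}" B "\<lambda>b. f [b]"] letters \<open>b \<in> B\<close> by auto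
    ultimately have "infsum f (lists (insert b D)) < \<infinity>"
      using fin loops[OF \<open>b \<in> B\<close>] unfolding \<Lambda>_def[symmetric]
      by (elim le_less_trans) (simp add: ennreal_mult_less_top)
    then show ?case
      by (simp add: D_def)
  qed
  from this[of F] F show ?thesis
    by (simp add: Un_absorb2 Un_commute)
qed

text \<open>A root test: if all fibers with q \<ge> 1 were at most
  \<open>K * exp (real q * r')\<close>, the weighted series would be dominated by a geometric series
  of ratio \<open>exp (r' - r)\<close>, which is below 1. The gap between r' and r makes room for an
  arbitrary constant K.\<close>

lemma large_fiber_if_weighted_infsum_infinite:
  fixes L :: "'b \<Rightarrow> ennreal" and h :: "'b \<Rightarrow> nat" and K r r' :: real
  assumes inf: "infsum (\<lambda>l. ennreal (exp (- r)) ^ h l * L l) A = \<infinity>"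
    and zero: "infsum L {l \<in> A. h l = 0} < \<infinity>" and "r' < r" "0 \<le> K"
  shows "\<exists>q\<ge>1. ennreal (K * exp (real q * r')) < infsum L {l \<in> A. h l = q}"
proof (rule ccontr)
  assume "\<not> ?thesis"
  then have small: "infsum L {l \<in> A. h l = q} \<le> ennreal (K * exp (real q * r'))" if "q \<ge> 1" for q
    using that not_le by blast
  define c0 where "c0 = enn2real (infsum L {l \<in> A. h l = 0})"
  have c0: "infsum L {l \<in> A. h l = 0} \<le> ennreal c0" "0 \<le> c0"
    using zero by (simp_all add: c0_def)
  \<comment> \<open>\<open>c0\<close> covers the fiber of value 0, about which the negated
    conclusion says nothing; \<open>K\<close> covers all others.\<close>
  define c where "c q = (c0 + K) * exp (r' - r) ^ q" for q
  have "infsum (\<lambda>l. ennreal (exp (- r)) ^ h l * L l) {l \<in> A. h l = q} \<le> ennreal (c q)" for q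
  proof -
    have "infsum L {l \<in> A. h l = q} \<le> ennreal ((c0 + K) * exp (real q * r'))"
    proof (cases "q = 0")
      case True
      then show ?thesis
        using c0 \<open>0 \<le> K\<close> by (auto intro: order_trans ennreal_leI)
    next
      case False
      then have "infsum L {l \<in> A. h l = q} \<le> ennreal (K * exp (real q * r'))"
        by (intro small) auto
      also have "\<dots> \<le> ennreal ((c0 + K) * exp (real q * r'))"
        using c0 by (intro ennreal_leI mult_right_mono) auto
      finally show ?thesis .
    qed
    then have "ennreal (exp (- r)) ^ q * infsum L {l \<in> A. h l = q}
      \<le> ennreal (exp (- r)) ^ q * ennreal ((c0 + K) * exp (real q * r'))"
      by (intro mult_left_mono) auto
    also have "\<dots> = ennreal (c q)"
      using c0 \<open>0 \<le> K\<close>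
      by (simp add: c_def ennreal_power ennreal_mult[symmetric] exp_of_nat_mult[symmetric]
          exp_add[symmetric] algebra_simps)
    also have "ennreal (exp (- r)) ^ q * infsum L {l \<in> A. h l = q}
        = infsum (\<lambda>l. ennreal (exp (- r)) ^ h l * L l) {l \<in> A. h l = q}"
      unfolding infsum_ennreal_cmult[symmetric] by (rule infsum_cong) auto
    finally show ?thesis .
  qed
  then have "infsum (\<lambda>l. ennreal (exp (- r)) ^ h l * L l) A \<le> (\<Sum>q. ennreal (c q))"
    by (rule infsum_ennreal_le_suminf_fibers)
  also have "\<dots> = ennreal (\<Sum>q. c q)"
    unfolding c_def using c0 \<open>0 \<le> K\<close> \<open>r' < r\<close>
    by (intro suminf_ennreal2 summable_mult summable_geometric) auto
  finally show False
    using inf by (simp add: top_unique)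
qed

section \<open>Cylinder weights and pressure\<close>

text \<open>The exponential of a Birkhoff sum in multiplicative form, so that weights may
  vanish.\<close>

definition orbit_prod :: "('a sequence \<Rightarrow> real) \<Rightarrow> nat \<Rightarrow> 'a sequence \<Rightarrow> real" where
  "orbit_prod g n \<omega> = (\<Prod>i<n. g ((shift ^^ i) \<omega>))"

text \<open>The number \<open>n\<close> of factors is independent of the length of \<open>w\<close>:
  letters beyond the first \<open>n\<close> prescribe where the orbit continues. An empty cylinder
  gets weight 0.\<close>

definition cyl_weight :: "'a sequence set \<Rightarrow> ('a sequence \<Rightarrow> real) \<Rightarrow> nat \<Rightarrow> 'a list \<Rightarrow> ennreal" where
  "cyl_weight Y g n w = (SUP \<omega>\<in>cyl Y w. ennreal (orbit_prod g n \<omega>))"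

lemma funpow_shift_apply: "(shift ^^ n) \<omega> i = \<omega> (n + i)"
  by (induction n arbitrary: i) (auto simp: shift_def)

lemma shift_funpow_markov_shift:
  assumes "\<omega> \<in> markov_shift S A"
  shows "(shift ^^ n) \<omega> \<in> markov_shift S A"
  using assms by (auto simp: markov_shift_def funpow_shift_apply)

lemma orbit_prod_add:
  "orbit_prod g (m + n) \<omega> = orbit_prod g m \<omega> * orbit_prod g n ((shift ^^ m) \<omega>)"
proof (induction n)
  case (Suc n)
  have "(shift ^^ n) ((shift ^^ m) \<omega>) = (shift ^^ (m + n)) \<omega>"
    by (metis add.commute comp_apply funpow_add)
  with Suc show ?case by (simp add: orbit_prod_def)
qed (simp add: orbit_prod_def)

lemma orbit_prod_Suc:
  "orbit_prod g (Suc n) \<omega> = orbit_prod g n \<omega> * g ((shift ^^ n) \<omega>)"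
  by (simp add: orbit_prod_def)

lemma orbit_prod_nonneg: "(\<And>\<omega>. 0 \<le> g \<omega>) \<Longrightarrow> 0 \<le> orbit_prod g n \<omega>"
  by (simp add: orbit_prod_def prod_nonneg)

lemma cyl_prefix: "\<omega> \<in> cyl Y (u @ v) \<Longrightarrow> \<omega> \<in> cyl Y u"
  by (auto simp: cyl_def nth_append)

lemma cyl_suffix:
  assumes "\<omega> \<in> cyl (markov_shift S A) (u @ v)"
  shows "(shift ^^ length u) \<omega> \<in> cyl (markov_shift S A) v"
  using assms by (auto simp: cyl_def nth_append shift_funpow_markov_shift funpow_shift_apply
      dest!: spec[of _ "length u + _"])

text \<open>The product along the orbit splits at time \<open>length u\<close>, when the point
  enters the cylinder of \<open>b @ v\<close>. The word \<open>b\<close> appears on both sides of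
  the cut: it is the target of the first stretch, whose factors stop before it, and the start of the
  second.\<close>

lemma cyl_weight_overlap:
  assumes "\<And>\<omega>. 0 \<le> g \<omega>"
  shows "cyl_weight (markov_shift S A) g (length u + n) (u @ b @ v) \<le>
    cyl_weight (markov_shift S A) g (length u) (u @ b) * cyl_weight (markov_shift S A) g n (b @ v)"
  unfolding cyl_weight_def[of _ _ "length u + n"]
proof (rule SUP_least)
  fix \<omega> assume \<omega>: "\<omega> \<in> cyl (markov_shift S A) (u @ b @ v)"
  have "ennreal (orbit_prod g (length u + n) \<omega>)
      = ennreal (orbit_prod g (length u) \<omega>) * ennreal (orbit_prod g n ((shift ^^ length u) \<omega>))"
    using assms by (simp add: orbit_prod_add ennreal_mult orbit_prod_nonneg)
  also have "\<dots> \<le> cyl_weight (markov_shift S A) g (length u) (u @ b)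
      * cyl_weight (markov_shift S A) g n (b @ v)"
    unfolding cyl_weight_def using \<omega> cyl_prefix[of \<omega> _ "u @ b" v]
    by (intro mult_mono SUP_upper cyl_suffix) auto
  finally show "ennreal (orbit_prod g (length u + n) \<omega>) \<le> \<dots>" .
qed

lemma cyl_weight_append:
  assumes "\<And>\<omega>. 0 \<le> g \<omega>"
  shows "cyl_weight (markov_shift S A) g (length u + n) (u @ v) \<le>
    cyl_weight (markov_shift S A) g (length u) u * cyl_weight (markov_shift S A) g n v"
  using cyl_weight_overlap[where b = "[]", OF assms] by simp

lemma cyl_weight_0: "cyl_weight Y g 0 w \<le> 1"
  by (auto simp: cyl_weight_def orbit_prod_def SUP_le_iff)

lemma cyl_weight_singleton_le:
  assumes "\<And>\<omega>. \<omega> \<in> Y \<Longrightarrow> ennreal (g \<omega>) \<le> a (\<omega> 0)"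
  shows "cyl_weight Y g 1 [s] \<le> a s"
  using assms by (auto simp: cyl_weight_def orbit_prod_def cyl_def intro!: SUP_least)

lemma infsum_cyl_weight_le:
  assumes "\<And>\<omega>. 0 \<le> g \<omega>"
    and "\<And>\<omega>. \<omega> \<in> markov_shift S A \<Longrightarrow> ennreal (g \<omega>) \<le> a (\<omega> 0)"
  shows "infsum (cyl_weight (markov_shift S A) g n) (words B n) \<le> infsum a B ^ n"
proof -
  let ?f = "\<lambda>w. cyl_weight (markov_shift S A) g (length w) w"
  have "infsum (cyl_weight (markov_shift S A) g n) (words B n) = infsum ?f (words B n)"
    by (rule infsum_cong) (auto simp: words_def)
  also have "\<dots> \<le> (infsum (\<lambda>s. ?f [s]) B) ^ n"
    using assms(1) by (intro infsum_words_le_power) (auto simp: cyl_weight_0 cyl_weight_append)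
  also have "\<dots> \<le> infsum a B ^ n"
    using cyl_weight_singleton_le[where Y = "markov_shift S A" and g = g and a = a, OF assms(2)]
    by (intro power_mono infsum_ennreal_mono) auto
  finally show ?thesis .
qed

section \<open>Partition functions as sums of cylinder weights\<close>

lemma ereal_exp_mono: "x \<le> y \<Longrightarrow> ereal_exp x \<le> ereal_exp y"
  by (cases x; cases y) (auto simp: ereal_exp_def ennreal_leI)

text \<open>\<open>ereal_exp\<close> is increasing and continuous for its conventional values, so an
  empty supremum gives 0 on both sides and an unbounded one gives \<infinity>.\<close>

lemma ereal_exp_SUP:
  "ereal_exp (SUP x\<in>C. ereal (f x)) = (SUP x\<in>C. ennreal (exp (f x)))"
proof (rule antisym)
  let ?s = "SUP x\<in>C. ereal (f x)"
  show "ereal_exp ?s \<le> (SUP x\<in>C. ennreal (exp (f x)))"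
  proof (rule dense_le)
    fix c assume c: "c < ereal_exp ?s"
    then obtain c' where c': "c = ennreal c'" "0 \<le> c'"
      by (cases c) auto
    show "c \<le> (SUP x\<in>C. ennreal (exp (f x)))"
    \<comment> \<open>The value 0 is split off because \<open>ln c'\<close> serves as a test value
      below.\<close>
    proof (cases "c' = 0")
      case False
      with c' have "0 < c'" by simp
      then have "ereal (ln c') < ?s"
        using c c' by (cases ?s) (auto simp: ereal_exp_def ennreal_less_iff
            simp flip: exp_less_cancel_iff[of "ln c'"])
      then obtain x where x: "x \<in> C" "ln c' < f x"
        by (auto simp: less_SUP_iff)
      then have "c' \<le> exp (f x)"
        using \<open>0 < c'\<close> by (metis exp_le_cancel_iff exp_ln less_imp_le)
      with x show ?thesis
        unfolding c' by (intro SUP_upper2[of x]) (auto intro: ennreal_leI)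
    qed (use c' in simp)
  qed
  show "(SUP x\<in>C. ennreal (exp (f x))) \<le> ereal_exp ?s"
  proof (rule SUP_least)
    fix x assume "x \<in> C"
    then have "ereal_exp (ereal (f x)) \<le> ereal_exp ?s"
      by (intro ereal_exp_mono SUP_upper)
    then show "ennreal (exp (f x)) \<le> ereal_exp ?s"
      by (simp add: ereal_exp_def)
  qed
qed

text \<open>Words with an empty cylinder have weight 0, so leaving them out, as
  \<open>partition_fun\<close> does, does not change the sum.\<close>

lemma partition_fun_eq_infsum_cyl_weight:
  "partition_fun S Y \<phi> n = infsum (cyl_weight Y (\<lambda>\<omega>. exp (\<phi> \<omega>)) n) (words S n)"
  unfolding partition_fun_def
  by (rule infsum_cong_neutral)
     (auto simp: ereal_exp_SUP cyl_weight_def orbit_prod_def birkhoff_sum_def exp_sum bot_ennreal)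

lemma partition_fun_0: "partition_fun S Y \<phi> 0 \<le> 1"
  by (simp add: partition_fun_eq_infsum_cyl_weight words_0 cyl_weight_0)

lemma partition_fun_add_le:
  "partition_fun S (markov_shift S' A) \<phi> (m + n) \<le>
   partition_fun S (markov_shift S' A) \<phi> m * partition_fun S (markov_shift S' A) \<phi> n"
  unfolding partition_fun_eq_infsum_cyl_weight words_add
proof (rule infsum_ennreal_image_Times_le)
  fix u v assume "u \<in> words S m"
  then have "length u = m" by (simp add: words_def)
  then show "cyl_weight (markov_shift S' A) (\<lambda>\<omega>. exp (\<phi> \<omega>)) (m + n) (u @ v)
     \<le> cyl_weight (markov_shift S' A) (\<lambda>\<omega>. exp (\<phi> \<omega>)) m u *
       cyl_weight (markov_shift S' A) (\<lambda>\<omega>. exp (\<phi> \<omega>)) n v"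
    using cyl_weight_append[where g = "\<lambda>\<omega>. exp (\<phi> \<omega>)" and u = u] by simp
qed

section \<open>Fekete's lemma and criteria for bounds on the pressure\<close>

text \<open>Reduces comparisons of rates to inequalities in \<open>ennreal\<close>; the logarithms
  of 0 and \<infinity> are dealt with here once and for all.\<close>

lemma growth_le_iff:
  assumes "n \<ge> 1"
  shows "ereal (1 / real n) * ennreal_ln z \<le> ereal \<rho> \<longleftrightarrow> z \<le> ennreal (exp (real n * \<rho>))"
proof (cases z)
  case (real r)
  show ?thesis
  proof (cases "r = 0")
    case True
    then show ?thesis using real assms by (simp add: ennreal_ln_def)
  next
    case False
    then have "ennreal_ln z = ereal (ln r)"
      using real by (simp add: ennreal_ln_def)
    moreover have "ln r / real n \<le> \<rho> \<longleftrightarrow> r \<le> exp (real n * \<rho>)"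
    proof -
      have "r \<le> exp (real n * \<rho>) \<longleftrightarrow> ln r \<le> real n * \<rho>"
        using False real by (metis exp_le_cancel_iff exp_ln less_eq_real_def)
      then show ?thesis
        using assms by (simp add: divide_le_eq mult.commute)
    qed
    ultimately show ?thesis
      using real by (simp add: ennreal_le_iff)
  qed
next
  case top
  then show ?thesis using assms by (simp add: ennreal_ln_def top_unique)
qed

lemma submultiplicative_growth_tendsto:
  fixes Z :: "nat \<Rightarrow> ennreal"
  assumes Z0: "Z 0 \<le> 1" and Z1: "Z 1 < \<infinity>" and submult: "\<And>m n. Z (m + n) \<le> Z m * Z n"
  shows "(\<lambda>n. ereal (1 / real n) * ennreal_ln (Z n)) \<longlonglongrightarrow>
    (INF n\<in>{1..}. ereal (1 / real n) * ennreal_ln (Z n))"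
proof (rule order_tendstoI)
  let ?u = "\<lambda>n. ereal (1 / real n) * ennreal_ln (Z n)"
  fix a assume "a < (INF n\<in>{1..}. ?u n)"
  then have "a < ?u n" if "n \<ge> 1" for n
    using that by (auto dest: less_INF_D)
  then show "\<forall>\<^sub>F n in sequentially. a < ?u n"
    by (auto simp: eventually_sequentially)
next
  let ?u = "\<lambda>n. ereal (1 / real n) * ennreal_ln (Z n)"
  fix a assume "(INF n\<in>{1..}. ?u n) < a"
  then obtain N where N: "N \<ge> 1" "?u N < a"
    by (auto simp: INF_less_iff)
  \<comment> \<open>Two real rates are placed between \<open>?u N\<close> and \<open>a\<close>:
    \<open>\<rho>'\<close> bounds the growth up to the factor \<open>exp K\<close>, and the gap up
    to \<open>\<rho>\<close> absorbs that factor for large n.\<close>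
  obtain \<rho>' where \<rho>': "?u N < ereal \<rho>'" "ereal \<rho>' < a"
    using ereal_dense2[OF N(2)] by blast
  obtain \<rho> where \<rho>: "\<rho>' < \<rho>" "ereal \<rho> < a"
    using ereal_dense2[OF \<rho>'(2)] by auto
  have ZN: "Z N \<le> ennreal (exp (real N * \<rho>'))"
    using growth_le_iff[OF N(1), of "Z N" \<rho>'] less_imp_le[OF \<rho>'(1)] by blast
  have mult: "Z (q * m) \<le> Z m ^ q" for q m
  proof (induction q)
    case (Suc q)
    have "Z (Suc q * m) \<le> Z m * Z (q * m)"
      using submult[of m "q * m"] by simp
    also have "\<dots> \<le> Z m * Z m ^ q"
      by (intro mult_left_mono Suc) simp
    finally show ?case by simp
  qed (use Z0 in simp)
  define c where "c = max 1 (enn2real (Z 1))"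
  have "c \<ge> 1" by (simp add: c_def)
  have "Z 1 \<le> ennreal c"
    using Z1 by (cases "Z 1") (auto simp: c_def intro: ennreal_leI)
  \<comment> \<open>The worst case of a remainder s \<le> N: the first term pays for replacing q N
    by n, the second for the factors \<open>Z 1\<close>. As \<open>c \<ge> 1\<close>,
    \<open>ln c\<close> is nonnegative.\<close>
  define K where "K = real N * \<bar>\<rho>'\<bar> + real N * ln c"
  have bound: "Z n \<le> ennreal (exp (real n * \<rho>' + K))" for n
  proof -
    define q s where "q = n div N" and "s = n mod N"
    have n: "n = q * N + s" "s \<le> N"
      using N(1) by (auto simp: q_def s_def less_imp_le)
    have "Z n \<le> Z (q * N) * Z (s * 1)"
      using submult[of "q * N" s] n by simp
    also have "\<dots> \<le> Z N ^ q * Z 1 ^ s"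
      by (intro mult_mono mult) auto
    also have "\<dots> \<le> ennreal (exp (real N * \<rho>')) ^ q * ennreal c ^ s"
      using \<open>Z 1 \<le> ennreal c\<close> ZN by (intro mult_mono power_mono) auto
    also have "\<dots> = ennreal (exp (real N * \<rho>') ^ q * c ^ s)"
      using \<open>c \<ge> 1\<close> by (simp add: ennreal_power ennreal_mult)
    also have "c ^ s = exp (real s * ln c)"
      using \<open>c \<ge> 1\<close> by (simp add: exp_of_nat_mult)
    also have "exp (real N * \<rho>') ^ q * exp (real s * ln c) = exp (real q * (real N * \<rho>') + real s * ln c)"
      by (simp add: exp_of_nat_mult exp_add)
    also have "ennreal \<dots> \<le> ennreal (exp (real n * \<rho>' + K))"
    proof -
      have "real s * ln c \<le> real N * ln c"
        using n \<open>c \<ge> 1\<close> by (intro mult_right_mono) auto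
      moreover have "- (real s * \<rho>') \<le> real N * \<bar>\<rho>'\<bar>"
      proof -
        have "- (real s * \<rho>') \<le> real s * \<bar>\<rho>'\<bar>"
          by (simp add: abs_if mult_nonneg_nonpos mult_le_0_iff)
        also have "\<dots> \<le> real N * \<bar>\<rho>'\<bar>"
          using n by (intro mult_right_mono) auto
        finally show ?thesis .
      qed
      moreover have "real n * \<rho>' = real q * (real N * \<rho>') + real s * \<rho>'"
        using n(1) by (simp add: algebra_simps)
      ultimately show ?thesis
        by (intro ennreal_leI) (simp add: K_def)
    qed
    finally show ?thesis .
  qed
  obtain n0 :: nat where n0: "K / (\<rho> - \<rho>') \<le> real n0"
    using real_arch_simple by blast
  have "?u n < a" if "n \<ge> max 1 n0" for n
  proof -
    have "K / (\<rho> - \<rho>') \<le> real n"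
      using n0 that by simp
    then have "real n * \<rho>' + K \<le> real n * \<rho>"
      using \<rho>(1) by (simp add: divide_le_eq algebra_simps)
    then have "Z n \<le> ennreal (exp (real n * \<rho>))"
      using bound[of n] by (meson order_trans ennreal_leI exp_le_cancel_iff)
    then have "?u n \<le> ereal \<rho>"
      using that by (subst growth_le_iff) auto
    with \<rho>(2) show ?thesis by simp
  qed
  then show "\<forall>\<^sub>F n in sequentially. ?u n < a"
    unfolding eventually_sequentially by blast
qed

text \<open>By Fekete's lemma the limit is an infimum over all lengths, so one length
  suffices.\<close>

lemma pressure_le_if_partition_fun_le:
  assumes "partition_fun S (markov_shift S' A) \<phi> 1 < \<infinity>"
    and "n \<ge> 1" "partition_fun S (markov_shift S' A) \<phi> n \<le> ennreal (exp (real n * \<rho>))"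
  shows "pressure S (markov_shift S' A) \<phi> \<le> ereal \<rho>"
proof -
  let ?u = "\<lambda>n. ereal (1 / real n) * ennreal_ln (partition_fun S (markov_shift S' A) \<phi> n)"
  have "pressure S (markov_shift S' A) \<phi> = (INF n\<in>{1..}. ?u n)"
    unfolding pressure_def
    by (intro limI submultiplicative_growth_tendsto partition_fun_0 partition_fun_add_le assms)
  also have "\<dots> \<le> ?u n"
    using assms by (intro INF_lower) auto
  also have "\<dots> \<le> ereal \<rho>"
    using assms by (simp add: growth_le_iff)
  finally show ?thesis .
qed

text \<open>The limit exists, so the lengths \<open>m * N\<close> determine it; these are the
  lengths of concatenations of loops of length N.\<close>

lemma pressure_ge_if_partition_fun_ge:
  assumes "partition_fun S (markov_shift S' A) \<phi> 1 < \<infinity>" and "N \<ge> 1"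
    and ge: "\<And>m. m \<ge> 1 \<Longrightarrow>
      ennreal (exp (real (m * N) * \<rho>)) \<le> partition_fun S (markov_shift S' A) \<phi> (m * N)"
  shows "ereal \<rho> \<le> pressure S (markov_shift S' A) \<phi>"
proof -
  let ?u = "\<lambda>n. ereal (1 / real n) * ennreal_ln (partition_fun S (markov_shift S' A) \<phi> n)"
  have lim: "?u \<longlonglongrightarrow> (INF n\<in>{1..}. ?u n)"
    by (intro submultiplicative_growth_tendsto partition_fun_0 partition_fun_add_le assms)
  then have eq: "pressure S (markov_shift S' A) \<phi> = (INF n\<in>{1..}. ?u n)"
    unfolding pressure_def by (rule limI)
  have "strict_mono (\<lambda>m. m * N)"
    using \<open>N \<ge> 1\<close> by (auto intro: strict_monoI)
  from LIMSEQ_subseq_LIMSEQ[OF lim this]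
  have "(\<lambda>m. ?u (m * N)) \<longlonglongrightarrow> pressure S (markov_shift S' A) \<phi>"
    by (simp add: eq o_def)
  moreover have "ereal \<rho> \<le> ?u (m * N)" if "m \<ge> 1" for m
  \<comment> \<open>\<open>growth_le_iff\<close> tests a rate from above, hence the detour through
    real numbers above the rate.\<close>
  proof (rule dense_ge)
    fix y assume "?u (m * N) < y"
    then obtain \<rho>' where \<rho>': "?u (m * N) < ereal \<rho>'" "ereal \<rho>' < y"
      using ereal_dense2 by blast
    have "m * N \<ge> 1" using that \<open>N \<ge> 1\<close> by simp
    from growth_le_iff[OF this, of "partition_fun S (markov_shift S' A) \<phi> (m * N)" \<rho>'] less_imp_le[OF \<rho>'(1)]
    have "partition_fun S (markov_shift S' A) \<phi> (m * N) \<le> ennreal (exp (real (m * N) * \<rho>'))"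
      by simp
    with ge[OF that] have "ennreal (exp (real (m * N) * \<rho>)) \<le> ennreal (exp (real (m * N) * \<rho>'))"
      by (rule order_trans)
    then have "\<rho> \<le> \<rho>'"
      using that \<open>N \<ge> 1\<close> by (simp add: ennreal_le_iff)
    with \<rho>'(2) show "ereal \<rho> \<le> y"
      by (metis ereal_less_eq(3) less_imp_le order_trans)
  qed
  ultimately show ?thesis
    by (intro LIMSEQ_le_const) auto
qed

section \<open>Concatenation of loops\<close>

lemma concat_words_image: "concat ` words (words S k) q = words S (q * k)"
proof (induction q)
  case (Suc q)
  have "concat ` words (words S k) (Suc q) = (\<lambda>(u, v). u @ v) ` (words S k \<times> concat ` words (words S k) q)"
    unfolding words_Suc image_image case_prod_unfold
    by (auto simp: image_iff Bex_def; blast)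
  also have "\<dots> = words S (Suc q * k)"
    by (simp add: Suc words_add)
  finally show ?case .
qed (simp add: words_0)

lemma inj_on_concat_words:
  assumes "\<And>x. x \<in> B \<Longrightarrow> length x = k"
  shows "inj_on concat (words B q)"
proof (rule inj_onI)
  fix xs ys assume *: "xs \<in> words B q" "ys \<in> words B q" "concat xs = concat ys"
  have "length x = k" if "x \<in> set xs \<union> set ys" for x
    using that * assms by (auto simp: words_def)
  then have "\<forall>(x, y)\<in>set (zip xs ys). length x = length y"
    by (auto dest: set_zip_leftD set_zip_rightD)
  with * show "xs = ys"
    by (subst (asm) concat_eq_concat_iff) (auto simp: words_def)
qed

lemma length_concat_words:
  assumes "\<And>x. x \<in> B \<Longrightarrow> length x = k" "xs \<in> words B q"
  shows "length (concat xs) = q * k"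
  using assms(2) by (induction xs arbitrary: q) (auto simp: words_def assms(1))

lemma nth_concat_words:
  assumes "\<And>x. x \<in> B \<Longrightarrow> length x = N" "xs \<in> words B m" "i < m * N"
  shows "concat xs ! i = xs ! (i div N) ! (i mod N)"
  using assms(2,3)
proof (induction xs arbitrary: m i)
  case (Cons x xs)
  then obtain m' where m: "m = Suc m'" "xs \<in> words B m'" and x: "length x = N"
    using assms(1) by (auto simp: words_def)
  show ?case
  proof (cases "i < N")
    case False
    then obtain t where t: "i = N + t"
      using le_Suc_ex not_le by blast
    then have "t < m' * N" "0 < N"
      using Cons.prems m by (auto intro: Nat.gr0I)
    then show ?thesis
      using t x Cons.IH[OF m(2) \<open>t < _\<close>] by (simp add: nth_append)
  qed (use x in \<open>simp add: nth_append\<close>)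
qed (auto simp: words_def)

lemma sum_words_prod_nth:
  fixes f :: "'b \<Rightarrow> 'c :: comm_semiring_1"
  assumes "finite B"
  shows "(\<Sum>xs\<in>words B m. \<Prod>j<m. f (xs ! j)) = sum f B ^ m"
proof (induction m)
  case (Suc m)
  have "(\<Sum>xs\<in>words B (Suc m). \<Prod>j<Suc m. f (xs ! j))
      = (\<Sum>(x, xs)\<in>B \<times> words B m. f x * (\<Prod>j<m. f (xs ! j)))"
    unfolding words_Suc
    by (subst sum.reindex) (auto intro!: inj_onI sum.cong simp: prod.lessThan_Suc_shift simp del: prod.lessThan_Suc)
  also have "\<dots> = sum f B * (\<Sum>xs\<in>words B m. \<Prod>j<m. f (xs ! j))"
    by (simp add: sum_product sum.cartesian_product)
  finally show ?case by (simp add: Suc)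
qed (simp add: words_0)

lemma orbit_prod_mult_eq: "orbit_prod g (m * N) \<omega> = (\<Prod>j<m. orbit_prod g N ((shift ^^ (j * N)) \<omega>))"
proof (induction m)
  case (Suc m)
  have "orbit_prod g (Suc m * N) \<omega> = orbit_prod g (m * N + N) \<omega>"
    by (simp add: add.commute)
  also have "\<dots> = (\<Prod>j<Suc m. orbit_prod g N ((shift ^^ (j * N)) \<omega>))"
    by (simp only: orbit_prod_add Suc prod.lessThan_Suc)
  finally show ?case .
qed (simp add: orbit_prod_def)

(* Words in \<Lambda> are loops at the block b: each starts with b, and may be followed by b. Hence any
   sequence of them can be concatenated. *)
lemma loop_words_partition_ge:
  fixes L :: "'a list \<Rightarrow> real"
  assumes fin: "finite \<Lambda>" and "N \<ge> 1" "b \<noteq> []" "length b \<le> N"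
    and support: "\<And>i j. M i j = 1 \<Longrightarrow> i \<in> S0 \<and> j \<in> S0"
    and \<Lambda>: "\<And>l. l \<in> \<Lambda> \<Longrightarrow> length l = N \<and> set l \<subseteq> S \<and> take (length b) l = b"
    and adm: "\<And>l i. l \<in> \<Lambda> \<Longrightarrow> i < N \<Longrightarrow> M ((l @ b) ! i) ((l @ b) ! Suc i) = 1"
    and L_nonneg: "\<And>l. l \<in> \<Lambda> \<Longrightarrow> 0 \<le> L l"
    and h: "\<And>l y. l \<in> \<Lambda> \<Longrightarrow> y \<in> cyl (markov_shift S0 M) (l @ b) \<Longrightarrow> L l \<le> orbit_prod h N y"
    and Y: "markov_shift S0 M \<subseteq> Y"
    and m: "m \<ge> 1"
  shows "ennreal (sum L \<Lambda> ^ m) \<le> infsum (cyl_weight Y h (m * N)) (words S (m * N))"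
proof -
  have len: "length l = N" if "l \<in> \<Lambda>" for l
    using \<Lambda> that by simp
  have weight: "ennreal (\<Prod>j<m. L (ls ! j)) \<le> cyl_weight Y h (m * N) (concat ls)"
    if ls: "ls \<in> words \<Lambda> m" for ls
  proof -
    \<comment> \<open>The periodic point that repeats \<open>concat ls\<close>; \<open>mod m\<close>
      lets the first loop follow the last.\<close>
    define \<omega> where "\<omega> i = ls ! ((i div N) mod m) ! (i mod N)" for i
    have ls_nth: "ls ! (j mod m) \<in> \<Lambda>" for j
    proof -
      have "j mod m < length ls" "set ls \<subseteq> \<Lambda>"
        using ls m by (simp_all add: words_def)
      then show ?thesis
        using nth_mem by blast
    qed
    \<comment> \<open>From position j N on, \<open>\<omega>\<close> reads the j-th loop and then
      \<open>b\<close>, because the next loop begins with \<open>b\<close>;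
      \<open>length b \<le> N\<close> keeps this window inside two loops.\<close>
    have loop: "(shift ^^ (j * N)) \<omega> i = ((ls ! (j mod m)) @ b) ! i" if "i < N + length b" for i j
    proof (cases "i < N")
      case True
      then show ?thesis
        using \<Lambda>[OF ls_nth[of j]] by (simp add: funpow_shift_apply \<omega>_def nth_append)
    next
      case False
      define t where "t = i - N"
      have t: "i = N + t" "t < length b" "t < N"
        using False that \<open>length b \<le> N\<close> by (auto simp: t_def)
      have "j * N + i = Suc j * N + t"
        using t by simp
      moreover have "(Suc j * N + t) div N = Suc j"
        using t by (intro div_nat_eqI) auto
      moreover have "(Suc j * N + t) mod N = t"
        using t by (metis mod_less mod_mult_self3)
      ultimately have "(shift ^^ (j * N)) \<omega> i = ls ! (Suc j mod m) ! t"
        by (simp only: funpow_shift_apply \<omega>_def)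
      also have "\<dots> = take (length b) (ls ! (Suc j mod m)) ! t"
        using t by simp
      also have "\<dots> = b ! t"
        using \<Lambda>[OF ls_nth[of "Suc j"]] by simp
      finally show ?thesis
        using t \<Lambda>[OF ls_nth[of j]] by (simp add: nth_append)
    qed
    \<comment> \<open>For t = N - 1 the transition leaves the loop; it ends at the first letter of
      \<open>b\<close>, which the window still contains since \<open>b \<noteq> []\<close>.\<close>
    have M1: "M (\<omega> i) (\<omega> (Suc i)) = 1" for i
    proof -
      define j t where "j = i div N" and "t = i mod N"
      have "i = j * N + t" "t < N"
        using \<open>N \<ge> 1\<close> by (auto simp: j_def t_def)
      then show ?thesis
        using adm[OF ls_nth[of j] \<open>t < N\<close>] loop[of t j] loop[of "Suc t" j] \<open>b \<noteq> []\<close>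
        by (cases b) (auto simp: funpow_shift_apply)
    qed
    then have \<omega>: "\<omega> \<in> markov_shift S0 M"
      using support by (auto simp: markov_shift_def)
    have "(\<Prod>j<m. L (ls ! j)) \<le> (\<Prod>j<m. orbit_prod h N ((shift ^^ (j * N)) \<omega>))"
    proof (intro prod_mono conjI)
      fix j assume j: "j \<in> {..<m}"
      then show "0 \<le> L (ls ! j)"
        using L_nonneg[OF ls_nth[of j]] by simp
      have "(shift ^^ (j * N)) \<omega> \<in> cyl (markov_shift S0 M) ((ls ! j) @ b)"
        using shift_funpow_markov_shift[OF \<omega>] loop[of _ j] j \<Lambda>[OF ls_nth[of j]]
        by (auto simp: cyl_def)
      with h[OF ls_nth[of j]] j show "L (ls ! j) \<le> orbit_prod h N ((shift ^^ (j * N)) \<omega>)"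
        by simp
    qed
    also have "\<dots> = orbit_prod h (m * N) \<omega>"
      by (rule orbit_prod_mult_eq[symmetric])
    finally have "ennreal (\<Prod>j<m. L (ls ! j)) \<le> ennreal (orbit_prod h (m * N) \<omega>)"
      by (rule ennreal_leI)
    moreover have "\<omega> i = concat ls ! i" if "i < m * N" for i
    proof -
      have "i div N < m"
        using that by (simp add: less_mult_imp_div_less)
      then show ?thesis
        using nth_concat_words[OF len ls that] by (simp add: \<omega>_def)
    qed
    then have "\<omega> \<in> cyl Y (concat ls)"
      using \<omega> Y length_concat_words[OF len ls] by (auto simp: cyl_def)
    ultimately show ?thesis
      unfolding cyl_weight_def by (intro SUP_upper2[of \<omega>]) auto
  qed
  have fin_words: "finite (words \<Lambda> m)"
    unfolding words_def using finite_lists_length_eq[OF fin, of m] by (simp add: conj_commute)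
  \<comment> \<open>Expanding the power gives one product for each sequence of m loops, and
    \<open>concat\<close> is injective on such sequences, so each contributes a word of its
    own.\<close>
  have "ennreal (sum L \<Lambda> ^ m) = (\<Sum>ls\<in>words \<Lambda> m. ennreal (\<Prod>j<m. L (ls ! j)))"
    unfolding sum_words_prod_nth[OF fin, symmetric] using L_nonneg
    by (intro sum_ennreal[symmetric] prod_nonneg) (auto simp: words_def subset_iff)
  also have "\<dots> \<le> (\<Sum>ls\<in>words \<Lambda> m. cyl_weight Y h (m * N) (concat ls))"
    by (intro sum_mono weight)
  also have "\<dots> = sum (cyl_weight Y h (m * N)) (concat ` words \<Lambda> m)"
    using inj_on_concat_words[OF len] by (simp add: sum.reindex)
  also have "\<dots> \<le> infsum (cyl_weight Y h (m * N)) (words S (m * N))"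
  proof (rule sum_le_infsum_ennreal)
    have "words \<Lambda> m \<subseteq> words (words S N) m"
      using \<Lambda> by (auto simp: words_def)
    then show "concat ` words \<Lambda> m \<subseteq> words S (m * N)"
      using concat_words_image[of S N m] by blast
  qed (simp add: fin_words)
  finally show ?thesis .
qed

section \<open>Uniform convergence of orbit products on cylinders\<close>

lemma bounded_mult_image:
  fixes f g :: "'b \<Rightarrow> real"
  assumes "bounded (f ` A)" "bounded (g ` A)"
  shows "bounded ((\<lambda>x. f x * g x) ` A)"
proof -
  obtain b c where "\<forall>x\<in>A. \<bar>f x\<bar> \<le> b" "\<forall>x\<in>A. \<bar>g x\<bar> \<le> c"
    using assms by (auto simp: bounded_iff)
  then have "\<bar>f x * g x\<bar> \<le> b * c" if "x \<in> A" for x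
    using that unfolding abs_mult by (intro mult_mono) (auto intro: order_trans[OF abs_ge_zero])
  then show ?thesis
    by (auto simp: bounded_iff intro!: exI[of _ "b * c"])
qed

text \<open>Uniform limits may be multiplied when the limits are bounded, so boundedness is carried
  through the induction. Since \<open>n \<le> length w\<close>, the letter at every time i < n is
  fixed on the cylinder, and both the convergence on one-letter cylinders and the majorant
  \<open>a\<close> apply to each factor.\<close>

lemma uniform_limit_orbit_prod:
  assumes unif: "\<And>s. s \<in> S \<Longrightarrow> uniform_limit (cyl (markov_shift S A) [s]) g \<psi> F"
    and \<psi>: "\<And>\<omega>. 0 \<le> \<psi> \<omega>" "\<And>\<omega>. \<omega> \<in> markov_shift S A \<Longrightarrow> ennreal (\<psi> \<omega>) \<le> a (\<omega> 0)"
    and a: "\<And>s. s \<in> S \<Longrightarrow> a s < \<infinity>"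
    and "n \<le> length w" "set w \<subseteq> S"
  shows "uniform_limit (cyl (markov_shift S A) w) (\<lambda>\<epsilon>. orbit_prod (g \<epsilon>) n) (orbit_prod \<psi> n) F
    \<and> bounded (orbit_prod \<psi> n ` cyl (markov_shift S A) w)"
  using \<open>n \<le> length w\<close>
proof (induction n)
  case 0
  then show ?case
    by (auto simp: orbit_prod_def[abs_def] uniform_limit_iff bounded_iff intro!: exI[of _ 1])
next
  case (Suc n)
  let ?C = "cyl (markov_shift S A) w"
  have s: "w ! n \<in> S"
    using Suc.prems \<open>set w \<subseteq> S\<close> by (auto dest: nth_mem)
  have in_cyl: "(shift ^^ n) \<omega> \<in> cyl (markov_shift S A) [w ! n]" if "\<omega> \<in> ?C" for \<omega>
    using that Suc.prems by (auto simp: cyl_def shift_funpow_markov_shift funpow_shift_apply)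
  have "uniform_limit ?C (\<lambda>\<epsilon> \<omega>. g \<epsilon> ((shift ^^ n) \<omega>)) (\<lambda>\<omega>. \<psi> ((shift ^^ n) \<omega>)) F"
    using unif[OF s] in_cyl unfolding uniform_limit_iff by (fast elim: eventually_mono)
  moreover have "norm (\<psi> ((shift ^^ n) \<omega>)) \<le> enn2real (a (w ! n))" if "\<omega> \<in> ?C" for \<omega>
  proof -
    have "ennreal (\<psi> ((shift ^^ n) \<omega>)) \<le> a (w ! n)"
      using \<psi>(2)[of "(shift ^^ n) \<omega>"] in_cyl[OF that] by (auto simp: cyl_def)
    then show ?thesis
      using a[OF s] \<psi>(1)[of "(shift ^^ n) \<omega>"] by (cases "a (w ! n)") (auto simp: ennreal_le_iff)
  qed
  then have bdd: "bounded ((\<lambda>\<omega>. \<psi> ((shift ^^ n) \<omega>)) ` ?C)"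
    by (auto simp: bounded_iff)
  ultimately show ?case
    using Suc bounded_mult_image[of "orbit_prod \<psi> n" ?C "\<lambda>\<omega>. \<psi> ((shift ^^ n) \<omega>)"]
    unfolding orbit_prod_Suc[abs_def] by (auto intro!: uniform_lim_mult)
qed

section \<open>Growth of the degenerate weight\<close>

definition degenerate_weight :: "('a \<Rightarrow> 'a \<Rightarrow> nat) \<Rightarrow> ('a sequence \<Rightarrow> real) \<Rightarrow> 'a sequence \<Rightarrow> real" where
  "degenerate_weight M \<phi> = (\<lambda>\<omega>. if M (\<omega> 0) (\<omega> 1) = 1 then exp (\<phi> \<omega>) else 0)"

lemma orbit_prod_exp: "orbit_prod (\<lambda>\<omega>. exp (\<phi> \<omega>)) n \<omega> = exp (birkhoff_sum n \<phi> \<omega>)"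
  by (simp add: orbit_prod_def birkhoff_sum_def exp_sum)

lemma degenerate_weight_nonneg: "0 \<le> degenerate_weight M \<phi> \<omega>"
  by (simp add: degenerate_weight_def)

lemma orbit_prod_degenerate_weight_le:
  "orbit_prod (degenerate_weight M \<phi>) n \<omega> \<le> exp (birkhoff_sum n \<phi> \<omega>)"
  unfolding orbit_prod_exp[symmetric] orbit_prod_def
  by (intro prod_mono) (auto simp: degenerate_weight_def)

lemma orbit_prod_degenerate_weight_eq:
  assumes "\<omega> \<in> markov_shift S0 M"
  shows "orbit_prod (degenerate_weight M \<phi>) n \<omega> = exp (birkhoff_sum n \<phi> \<omega>)"
  unfolding orbit_prod_exp[symmetric] orbit_prod_def using assms
  by (intro prod.cong) (auto simp: degenerate_weight_def markov_shift_def funpow_shift_apply)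

lemma orbit_prod_degenerate_weight_pos_D:
  assumes "0 < orbit_prod (degenerate_weight M \<phi>) n \<omega>" "i < n"
  shows "M (\<omega> i) (\<omega> (Suc i)) = 1"
proof -
  have "degenerate_weight M \<phi> ((shift ^^ i) \<omega>) \<noteq> 0"
  proof
    assume "degenerate_weight M \<phi> ((shift ^^ i) \<omega>) = 0"
    then have "orbit_prod (degenerate_weight M \<phi>) n \<omega> = 0"
      unfolding orbit_prod_def using assms(2) by (intro prod_zero) auto
    then show False
      using assms(1) by simp
  qed
  then show ?thesis
    by (auto simp: degenerate_weight_def funpow_shift_apply split: if_splits)
qed

lemma infsum_words_blocks:
  fixes f :: "'a list \<Rightarrow> ennreal"
  shows "infsum f (words S (q * k)) = infsum (\<lambda>bl. f (concat bl)) (words (words S k) q)"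
  unfolding concat_words_image[symmetric]
  using infsum_reindex[OF inj_on_concat_words[of "words S k" k q], of f]
  by (simp add: o_def words_def)

text \<open>What the comparison of growth rates takes from the data: one summable majorant
  \<open>a\<close> for the perturbed weights and their limit, uniform convergence on one-letter
  cylinders, and a distortion constant \<open>D\<close> for Birkhoff sums over words read
  \<open>k\<close> letters too far.\<close>

locale degenerating_potential =
  fixes S S0 :: "'a set" and A M :: "'a \<Rightarrow> 'a \<Rightarrow> nat" and k :: nat
    and \<phi> :: "'a sequence \<Rightarrow> real" and \<phi>eps :: "real \<Rightarrow> 'a sequence \<Rightarrow> real"
    and a :: "'a \<Rightarrow> ennreal" and D :: real
  assumes k_pos: "k \<ge> 1"
    and M_support: "\<And>i j. M i j = 1 \<Longrightarrow> i \<in> S0 \<and> j \<in> S0"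
    and XM_subset: "markov_shift S0 M \<subseteq> markov_shift S A"
    and a_summable: "infsum a S < \<infinity>"
    and eps_le: "\<And>\<epsilon> \<omega>. \<epsilon> \<in> {0<..<1} \<Longrightarrow> \<omega> \<in> markov_shift S A \<Longrightarrow> ennreal (exp (\<phi>eps \<epsilon> \<omega>)) \<le> a (\<omega> 0)"
    and psi_le: "\<And>\<omega>. \<omega> \<in> markov_shift S A \<Longrightarrow> ennreal (degenerate_weight M \<phi> \<omega>) \<le> a (\<omega> 0)"
    and unif: "\<And>s. s \<in> S \<Longrightarrow> uniform_limit (cyl (markov_shift S A) [s])
      (\<lambda>\<epsilon> \<omega>. exp (\<phi>eps \<epsilon> \<omega>)) (degenerate_weight M \<phi>) (at_right 0)"
    and distortion: "\<And>n \<omega> \<upsilon>. \<omega> \<in> markov_shift S A \<Longrightarrow> \<upsilon> \<in> markov_shift S A \<Longrightarrow>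
      (\<forall>i<n + k. \<omega> i = \<upsilon> i) \<Longrightarrow> birkhoff_sum n \<phi> \<omega> \<le> birkhoff_sum n \<phi> \<upsilon> + D"
begin

abbreviation "X \<equiv> markov_shift S A"
abbreviation "XM \<equiv> markov_shift S0 M"
abbreviation "\<psi> \<equiv> degenerate_weight M \<phi>"
abbreviation "Z' n \<equiv> infsum (cyl_weight X \<psi> n) (words S n)"

text \<open>The generating series of the loops at \<open>b\<close>, evaluated at
  \<open>exp (- r)\<close>. Each block carries one such factor, so \<open>r\<close> is a rate per
  \<open>k\<close> letters. The trailing \<open>b\<close> closes the loop and supplies the
  \<open>k\<close> extra letters of the distortion bound.\<close>

definition loop_sum :: "real \<Rightarrow> 'a list \<Rightarrow> ennreal" where
  "loop_sum r b = infsum (\<lambda>l. ennreal (exp (- r)) ^ length l *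
     cyl_weight X \<psi> (length (concat l)) (concat l @ b)) {l \<in> lists (words S k). l = [] \<or> hd l = b}"

lemma a_finite: "s \<in> S \<Longrightarrow> a s < \<infinity>"
  using sum_le_infsum_ennreal[of "{s}" S a] a_summable by (auto intro: le_less_trans)

lemma eventually_eps: "\<forall>\<^sub>F \<epsilon> in at_right 0. \<epsilon> \<in> {0<..<(1::real)}"
  using eventually_at_right_real[of 0 1] by simp

lemma cyl_weight_le_prod:
  assumes "\<And>\<omega>. 0 \<le> g \<omega>" "\<And>\<omega>. \<omega> \<in> X \<Longrightarrow> ennreal (g \<omega>) \<le> a (\<omega> 0)"
  shows "cyl_weight X g (length w) w \<le> prod_list (map a w)"
proof (induction w)
  case (Cons s w)
  have "cyl_weight X g (length (s # w)) (s # w) \<le> cyl_weight X g 1 [s] * cyl_weight X g (length w) w"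
    using cyl_weight_append[where g = g and u = "[s]" and v = w, OF assms(1)] by simp
  also have "\<dots> \<le> a s * prod_list (map a w)"
    using assms by (intro mult_mono Cons cyl_weight_singleton_le) auto
  finally show ?case by simp
qed (simp add: cyl_weight_0)

lemma infsum_prod_list_finite: "infsum (\<lambda>w. prod_list (map a w)) (words S n) < \<infinity>"
proof -
  have "infsum (\<lambda>w. prod_list (map a w)) (words S n) \<le> (infsum (\<lambda>s. prod_list (map a [s])) S) ^ n"
    by (rule infsum_words_le_power) auto
  also have "\<dots> < \<infinity>"
    using a_summable by (simp add: power_less_top_ennreal)
  finally show ?thesis .
qed

lemma partition_fun_finite:
  assumes "\<epsilon> \<in> {0<..<1}"
  shows "partition_fun S X (\<phi>eps \<epsilon>) 1 < \<infinity>"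
proof -
  have "partition_fun S X (\<phi>eps \<epsilon>) 1 \<le> infsum a S ^ 1"
    unfolding partition_fun_eq_infsum_cyl_weight
    using eps_le[OF assms] by (intro infsum_cyl_weight_le) auto
  then show ?thesis
    using a_summable by (simp add: le_less_trans)
qed

text \<open>On X_M the weights \<open>\<psi>\<close> and exp \<phi> agree, and cylinders in X are
  larger. The reverse inequality can fail, which is why the lower bound goes through loops.\<close>

lemma partition_fun_XM_le: "partition_fun S XM \<phi> n \<le> Z' n"
  unfolding partition_fun_eq_infsum_cyl_weight
proof (rule infsum_ennreal_mono)
  fix w
  have "cyl_weight XM (\<lambda>\<omega>. exp (\<phi> \<omega>)) n w = cyl_weight XM \<psi> n w"
    unfolding cyl_weight_def
    by (intro SUP_cong) (auto simp: orbit_prod_exp orbit_prod_degenerate_weight_eq cyl_def)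
  also have "\<dots> \<le> cyl_weight X \<psi> n w"
    unfolding cyl_weight_def using XM_subset by (intro SUP_subset_mono) (auto simp: cyl_def)
  finally show "cyl_weight XM (\<lambda>\<omega>. exp (\<phi> \<omega>)) n w \<le> cyl_weight X \<psi> n w" .
qed

lemma Z'_finite: "Z' n < \<infinity>"
proof -
  have "Z' n \<le> infsum a S ^ n"
    using psi_le by (intro infsum_cyl_weight_le) (auto simp: degenerate_weight_nonneg)
  also have "\<dots> < \<infinity>"
    using a_summable by (simp add: power_less_top_ennreal)
  finally show ?thesis .
qed

lemma partition_fun_XM_finite: "partition_fun S XM \<phi> n < \<infinity>"
  using partition_fun_XM_le Z'_finite by (rule le_less_trans)

lemma uniform_limit_orbit_prod_eps:
  assumes "w \<in> words S n"
  shows "uniform_limit (cyl X (w @ v)) (\<lambda>\<epsilon>. orbit_prod (\<lambda>\<omega>. exp (\<phi>eps \<epsilon> \<omega>)) n) (orbit_prod \<psi> n) (at_right 0)"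
proof -
  have "uniform_limit (cyl X w) (\<lambda>\<epsilon>. orbit_prod (\<lambda>\<omega>. exp (\<phi>eps \<epsilon> \<omega>)) n) (orbit_prod \<psi> n) (at_right 0)"
    using assms by (intro uniform_limit_orbit_prod[where S = S and a = a, THEN conjunct1] unif psi_le a_finite)
      (auto simp: words_def degenerate_weight_nonneg)
  then show ?thesis
    by (rule uniform_limit_on_subset) (auto intro: cyl_prefix)
qed

lemma eventually_cyl_weight_le:
  assumes "w \<in> words S n" "0 < e"
  shows "\<forall>\<^sub>F \<epsilon> in at_right 0.
    cyl_weight X (\<lambda>\<omega>. exp (\<phi>eps \<epsilon> \<omega>)) n w \<le> cyl_weight X \<psi> n w + ennreal e"
proof -
  have "\<forall>\<^sub>F \<epsilon> in at_right 0. \<forall>\<omega>\<in>cyl X w.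
      dist (orbit_prod (\<lambda>\<omega>. exp (\<phi>eps \<epsilon> \<omega>)) n \<omega>) (orbit_prod \<psi> n \<omega>) < e"
    using uniform_limit_orbit_prod_eps[OF assms(1), of "[]"] \<open>0 < e\<close> by (simp add: uniform_limit_iff)
  then show ?thesis
  proof (rule eventually_mono)
    fix \<epsilon> assume *: "\<forall>\<omega>\<in>cyl X w. dist (orbit_prod (\<lambda>\<omega>. exp (\<phi>eps \<epsilon> \<omega>)) n \<omega>) (orbit_prod \<psi> n \<omega>) < e"
    show "cyl_weight X (\<lambda>\<omega>. exp (\<phi>eps \<epsilon> \<omega>)) n w \<le> cyl_weight X \<psi> n w + ennreal e"
      unfolding cyl_weight_def[of _ "\<lambda>\<omega>. exp (\<phi>eps \<epsilon> \<omega>)"]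
    proof (rule SUP_least)
      fix \<omega> assume \<omega>: "\<omega> \<in> cyl X w"
      have "orbit_prod (\<lambda>\<omega>. exp (\<phi>eps \<epsilon> \<omega>)) n \<omega> \<le> orbit_prod \<psi> n \<omega> + e"
        using * \<omega> by (fastforce simp: dist_real_def)
      then have "ennreal (orbit_prod (\<lambda>\<omega>. exp (\<phi>eps \<epsilon> \<omega>)) n \<omega>) \<le> ennreal (orbit_prod \<psi> n \<omega>) + ennreal e"
        using \<open>0 < e\<close> by (subst ennreal_plus[symmetric]) (auto intro: ennreal_leI orbit_prod_nonneg degenerate_weight_nonneg)
      also have "\<dots> \<le> cyl_weight X \<psi> n w + ennreal e"
        unfolding cyl_weight_def using \<omega> by (intro add_right_mono SUP_upper)
      finally show "ennreal (orbit_prod (\<lambda>\<omega>. exp (\<phi>eps \<epsilon> \<omega>)) n \<omega>) \<le> \<dots>" .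
    qed
  qed
qed

(* Dominated convergence, with the summable majorant w \<mapsto> a(w_0) ... a(w_{n-1}). *)
lemma eventually_partition_fun_le:
  assumes "Z' n < ennreal c"
  shows "\<forall>\<^sub>F \<epsilon> in at_right 0. partition_fun S X (\<phi>eps \<epsilon>) n \<le> ennreal c"
proof -
  define z where "z = enn2real (Z' n)"
  have z: "Z' n = ennreal z" "0 \<le> z"
    using Z'_finite[of n] by (simp_all add: z_def)
  then have "z < c"
    using assms by (simp add: ennreal_less_iff)
  \<comment> \<open>Half of the gap: one half is spent on the tail outside \<open>F\<close>, the
    other on the errors at the words in \<open>F\<close>.\<close>
  define d where "d = (c - z) / 2"
  have "0 < d" using \<open>z < c\<close> by (simp add: d_def)
  then have "0 < ennreal d" by simp
  obtain F where F: "finite F" "F \<subseteq> words S n"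
    "infsum (\<lambda>w. prod_list (map a w)) (words S n - F) < ennreal d"
    by (rule infsum_ennreal_tail[OF infsum_prod_list_finite[of n] \<open>0 < ennreal d\<close>])
  \<comment> \<open>The added 1 allows for an empty \<open>F\<close>.\<close>
  define e where "e = d / (real (card F) + 1)"
  have "0 < e" using \<open>0 < d\<close> by (simp add: e_def add_nonneg_pos)
  have "\<forall>\<^sub>F \<epsilon> in at_right 0. \<forall>w\<in>F.
      cyl_weight X (\<lambda>\<omega>. exp (\<phi>eps \<epsilon> \<omega>)) n w \<le> cyl_weight X \<psi> n w + ennreal e"
    using F \<open>0 < e\<close> by (intro eventually_ball_finite ballI eventually_cyl_weight_le) auto
  then show ?thesis
    using eventually_eps
  proof eventually_elim
    case (elim \<epsilon>)
    let ?g = "\<lambda>\<omega>. exp (\<phi>eps \<epsilon> \<omega>)"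
    have "partition_fun S X (\<phi>eps \<epsilon>) n = infsum (cyl_weight X ?g n) (F \<union> (words S n - F))"
      unfolding partition_fun_eq_infsum_cyl_weight using F by (simp add: Un_absorb1)
    also have "\<dots> \<le> infsum (cyl_weight X ?g n) F + infsum (cyl_weight X ?g n) (words S n - F)"
      by (rule infsum_ennreal_Un_le)
    also have "infsum (cyl_weight X ?g n) F \<le> (\<Sum>w\<in>F. cyl_weight X \<psi> n w + ennreal e)"
      using F elim(1) by (simp add: sum_mono)
    also have "\<dots> = sum (cyl_weight X \<psi> n) F + ennreal (real (card F) * e)"
      using \<open>0 < e\<close> by (simp add: sum.distrib ennreal_mult ennreal_of_nat_eq_real_of_nat)
    also have "sum (cyl_weight X \<psi> n) F \<le> ennreal z"
      using F unfolding z(1)[symmetric] by (intro sum_le_infsum_ennreal)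
    also have "ennreal (real (card F) * e) \<le> ennreal d"
      using \<open>0 < d\<close> by (intro ennreal_leI) (simp add: e_def divide_le_eq field_simps)
    also have "infsum (cyl_weight X ?g n) (words S n - F) \<le> infsum (\<lambda>w. prod_list (map a w)) (words S n - F)"
      using cyl_weight_le_prod[of ?g] eps_le[OF elim(2)]
      by (intro infsum_ennreal_mono) (auto simp: words_def)
    also have "\<dots> \<le> ennreal d"
      using F by simp
    finally have "partition_fun S X (\<phi>eps \<epsilon>) n \<le> ennreal z + ennreal d + ennreal d"
      by (simp add: add_mono)
    also have "\<dots> = ennreal c"
      using z(2) \<open>0 < d\<close> by (simp add: d_def flip: ennreal_plus)
    finally show ?case .
  qed
qed

section \<open>Loop series and the two pressures\<close>

text \<open>Finite loop series make the series over all words of blocks converge, which yields one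
  length with \<open>Z' (q * k) < ennreal (exp (real q * r))\<close>. Strictness is the gain: at a
  fixed length the inequality survives the passage to small \<epsilon>.\<close>

lemma pressures_le_if_loop_sums_finite:
  assumes "\<And>b. b \<in> words S k \<Longrightarrow> loop_sum r b < \<infinity>"
  shows "pressure S XM \<phi> \<le> ereal (r / real k)"
    and "\<forall>\<^sub>F \<epsilon> in at_right 0. pressure S X (\<phi>eps \<epsilon>) \<le> ereal (r / real k)"
proof -
  define x where "x = ennreal (exp (- r))"
  define f where "f l = x ^ length l * cyl_weight X \<psi> (length (concat l)) (concat l)" for l
  define g where "g l b = x ^ length l * cyl_weight X \<psi> (length (concat l)) (concat l @ b)" for l b
  have "infsum f (lists (words S k)) < \<infinity>"
  proof (rule infsum_lists_finite_if_loops_finite)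
    show "f [] \<le> 1"
      by (simp add: f_def cyl_weight_0)
    show "f (u @ v) \<le> f u * f v" for u v
      using mult_left_mono[OF cyl_weight_append[where g = \<psi> and S = S and A = A and u = "concat u"
          and v = "concat v" and n = "length (concat v)", OF degenerate_weight_nonneg], of "x ^ (length u + length v)"]
      by (simp add: f_def power_add mult_ac)
    show "f (l @ b # v) \<le> g l b * f (b # v)" for l b v
      using mult_left_mono[OF cyl_weight_overlap[where g = \<psi> and S = S and A = A and u = "concat l" and b = b
          and v = "concat v" and n = "length (concat (b # v))", OF degenerate_weight_nonneg],
          of "x ^ (length l + Suc (length v))"]
      by (simp add: f_def g_def power_add mult_ac)
    have "infsum (\<lambda>b. f [b]) (words S k) = x * Z' k"
      unfolding infsum_ennreal_cmult[symmetric]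
      by (rule infsum_cong) (auto simp: f_def words_def)
    then show "infsum (\<lambda>b. f [b]) (words S k) < \<infinity>"
      using Z'_finite[of k] by (simp add: x_def ennreal_mult_less_top)
    show "infsum (\<lambda>l. g l b) {l \<in> lists (words S k). l = [] \<or> hd l = b} < \<infinity>" if "b \<in> words S k" for b
      using assms[OF that] by (simp add: loop_sum_def g_def x_def)
  qed
  then obtain q where q: "q \<ge> 1" "infsum f {l \<in> lists (words S k). length l = q} < 1"
    using infsum_ennreal_small_fiber by blast
  have "infsum f {l \<in> lists (words S k). length l = q} = x ^ q * Z' (q * k)"
    unfolding infsum_words_blocks infsum_ennreal_cmult[symmetric] words_eq_lists[symmetric]
    using length_concat_words[of "words S k" k _ q]
    by (intro infsum_cong) (simp add: f_def words_def[of S] words_eq_lists)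
  with q(2) have less: "x ^ q * Z' (q * k) < 1"
    by simp
  let ?c = "exp (real (q * k) * (r / real k))"
  have c: "?c = exp (real q * r)"
    using k_pos by simp
  have Z'_less: "Z' (q * k) < ennreal ?c"
  proof (rule ccontr)
    assume "\<not> ?thesis"
    then have "x ^ q * ennreal ?c \<le> x ^ q * Z' (q * k)"
      by (intro mult_left_mono) auto
    moreover have "x ^ q * ennreal ?c = 1"
      unfolding c x_def by (simp add: ennreal_power flip: ennreal_mult exp_of_nat_mult exp_add)
    ultimately show False
      using less by simp
  qed
  have qk: "q * k \<ge> 1"
    using q(1) k_pos by simp
  show "pressure S XM \<phi> \<le> ereal (r / real k)"
    using partition_fun_XM_le[of "q * k"] Z'_less
    by (intro pressure_le_if_partition_fun_le[OF partition_fun_XM_finite qk]) simp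
  show "\<forall>\<^sub>F \<epsilon> in at_right 0. pressure S X (\<phi>eps \<epsilon>) \<le> ereal (r / real k)"
    using eventually_partition_fun_le[OF Z'_less] eventually_eps
    by eventually_elim (intro pressure_le_if_partition_fun_le[OF partition_fun_finite qk])
qed

text \<open>The two points play different roles: \<open>y\<close> lies in X_M, where
  \<open>\<psi>\<close> equals exp \<phi> along the orbit, while for \<open>y'\<close> in X the
  inequality between \<open>\<psi>\<close> and exp \<phi> is enough.\<close>

lemma distortion_orbit_prod:
  assumes "y \<in> cyl XM w" "y' \<in> cyl X w" "length w = n + k"
  shows "exp (- D) * orbit_prod \<psi> n y' \<le> orbit_prod \<psi> n y"
proof -
  have "birkhoff_sum n \<phi> y' \<le> birkhoff_sum n \<phi> y + D"
    using assms XM_subset by (intro distortion) (auto simp: cyl_def)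
  then have "exp (- D) * exp (birkhoff_sum n \<phi> y') \<le> exp (birkhoff_sum n \<phi> y)"
    by (simp flip: exp_add)
  moreover have "exp (- D) * orbit_prod \<psi> n y' \<le> exp (- D) * exp (birkhoff_sum n \<phi> y')"
    by (intro mult_left_mono orbit_prod_degenerate_weight_le) simp
  moreover have "orbit_prod \<psi> n y = exp (birkhoff_sum n \<phi> y)"
    using assms(1) by (intro orbit_prod_degenerate_weight_eq[of _ S0]) (simp add: cyl_def)
  ultimately show ?thesis
    by (simp only: order_trans)
qed

text \<open>Divergence at r gives loops of some fixed number q of blocks with total weight above
  \<open>exp (real q * r') / c\<close>. They concatenate freely, and the surplus
  \<open>1 / c\<close> pays for replacing suprema over X by values on X_M and \<open>\<psi>\<close>
  by the perturbed weights.\<close>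

lemma pressures_ge_if_loop_sum_infinite:
  assumes b: "b \<in> words S k" and inf: "loop_sum r b = \<infinity>" and "r' < r"
  shows "ereal (r' / real k) \<le> pressure S XM \<phi>"
    and "\<forall>\<^sub>F \<epsilon> in at_right 0. ereal (r' / real k) \<le> pressure S X (\<phi>eps \<epsilon>)"
proof -
  define B where "B = {l \<in> lists (words S k). l = [] \<or> hd l = b}"
  define W where "W l = cyl_weight X \<psi> (length (concat l)) (concat l @ b)" for l
  \<comment> \<open>\<open>exp (- D)\<close> is the cost of distortion; the 2 leaves a margin of
    size \<open>c * L w\<close> for the approximation by the perturbed weights.\<close>
  define c where "c = exp (- D) / 2"
  have "0 < c" by (simp add: c_def)
  have "{l \<in> B. length l = 0} = {[]}"
    by (auto simp: B_def)
  then have "infsum W {l \<in> B. length l = 0} < \<infinity>"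
    using cyl_weight_0[of X \<psi> b] by (simp add: W_def le_less_trans[OF _ ennreal_one_less_top])
  moreover have "infsum (\<lambda>l. ennreal (exp (- r)) ^ length l * W l) B = \<infinity>"
    using inf by (simp add: loop_sum_def W_def B_def)
  ultimately obtain q where q: "q \<ge> 1"
    "ennreal (1 / c * exp (real q * r')) < infsum W {l \<in> B. length l = q}"
    using large_fiber_if_weighted_infsum_infinite[of r length W B r' "1 / c"] \<open>r' < r\<close> \<open>0 < c\<close>
    by auto
  then obtain \<Lambda>' where \<Lambda>': "finite \<Lambda>'" "\<Lambda>' \<subseteq> {l \<in> B. length l = q}"
    "ennreal (1 / c * exp (real q * r')) < sum W \<Lambda>'"
    unfolding infsum_ennreal_eq_SUP less_SUP_iff by auto
  define N where "N = q * k"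
  have "N \<ge> 1" "k \<le> N"
    using q(1) k_pos by (auto simp: N_def)
  define V where "V w = cyl_weight X \<psi> N (w @ b)" for w
  define L where "L w = enn2real (V w)" for w
  \<comment> \<open>Positive weight makes a loop follow M and gives it a positive margin for the
    approximation.\<close>
  define \<Lambda> where "\<Lambda> = {w \<in> concat ` \<Lambda>'. 0 < V w}"
  have \<Lambda>'_words: "\<Lambda>' \<subseteq> words (words S k) q"
    using \<Lambda>'(2) by (auto simp: words_eq_lists[of "words S k"] B_def)
  have len_k: "length x = k" if "x \<in> words S k" for x
    using that by (simp add: words_def)
  have finite_V: "V w < \<infinity>" if "w \<in> words S N" for w
  proof -
    have "V w \<le> cyl_weight X \<psi> N w"
      unfolding V_def cyl_weight_def by (intro SUP_subset_mono) (auto intro: cyl_prefix)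
    also have "\<dots> \<le> Z' N"
      using sum_le_infsum_ennreal[of "{w}" "words S N" "cyl_weight X \<psi> N"] that by simp
    finally show ?thesis
      using Z'_finite[of N] by (rule le_less_trans)
  qed
  have words_\<Lambda>: "w \<in> words S N" if "w \<in> \<Lambda>" for w
    using that \<Lambda>'_words concat_words_image[of S k q] by (auto simp: \<Lambda>_def N_def)
  have V_eq: "V w = ennreal (L w)" if "w \<in> \<Lambda>" for w
    using finite_V[OF words_\<Lambda>[OF that]] by (simp add: L_def)
  have L_pos: "0 < L w" if "w \<in> \<Lambda>" for w
    using V_eq[OF that] that by (simp add: \<Lambda>_def)
  have sum_L: "exp (real q * r') \<le> sum (\<lambda>w. c * L w) \<Lambda>"
  proof -
    have "sum W \<Lambda>' = sum V (concat ` \<Lambda>')"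
    proof (subst sum.reindex)
      show "inj_on concat \<Lambda>'"
        using inj_on_concat_words[OF len_k] \<Lambda>'_words by (rule inj_on_subset)
      show "sum W \<Lambda>' = sum (V \<circ> concat) \<Lambda>'"
        using \<Lambda>'_words length_concat_words[OF len_k, where q = q]
        by (intro sum.cong) (auto simp: V_def W_def N_def)
    qed
    also have "\<dots> = sum V \<Lambda>"
      unfolding \<Lambda>_def using \<Lambda>'(1) by (intro sum.mono_neutral_right) (auto simp: zero_less_iff_neq_zero)
    also have "\<dots> = (\<Sum>w\<in>\<Lambda>. ennreal (L w))"
      by (intro sum.cong V_eq) auto
    also have "\<dots> = ennreal (sum L \<Lambda>)"
      by (intro sum_ennreal) (simp add: L_def)
    finally have "1 / c * exp (real q * r') < sum L \<Lambda>"
      using \<Lambda>'(3) \<open>0 < c\<close> by (simp add: ennreal_less_iff)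
    then show ?thesis
      using \<open>0 < c\<close> by (simp add: sum_distrib_left[symmetric] divide_less_eq mult.commute less_imp_le)
  qed
  have "\<Lambda> \<subseteq> concat ` \<Lambda>'" and fin: "finite \<Lambda>"
    using \<Lambda>'(1) by (auto simp: \<Lambda>_def)
  \<comment> \<open>Here \<open>\<theta>\<close> is a potential: the bound is used for X_M with
    \<phi> and for X with the perturbed potentials.\<close>
  have ge: "ennreal (exp (real (m * N) * (r' / real k))) \<le> partition_fun S Y \<theta> (m * N)"
    if m: "m \<ge> 1" and Y: "XM \<subseteq> Y"
      and h: "\<And>w y. w \<in> \<Lambda> \<Longrightarrow> y \<in> cyl XM (w @ b) \<Longrightarrow> c * L w \<le> orbit_prod (\<lambda>\<omega>. exp (\<theta> \<omega>)) N y"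
    for m Y \<theta>
  proof -
    have "exp (real (m * N) * (r' / real k)) = exp (real q * r') ^ m"
      using k_pos by (simp add: N_def flip: exp_of_nat_mult)
    also have "\<dots> \<le> sum (\<lambda>w. c * L w) \<Lambda> ^ m"
      by (intro power_mono sum_L) simp
    finally have "ennreal (exp (real (m * N) * (r' / real k))) \<le> ennreal (sum (\<lambda>w. c * L w) \<Lambda> ^ m)"
      by (rule ennreal_leI)
    also have "\<dots> \<le> infsum (cyl_weight Y (\<lambda>\<omega>. exp (\<theta> \<omega>)) (m * N)) (words S (m * N))"
    proof (rule loop_words_partition_ge[where M = M and ?S0.0 = S0 and b = b])
      show "b \<noteq> []" "length b \<le> N"
        using len_k[OF b] k_pos \<open>k \<le> N\<close> by auto
      fix w assume w: "w \<in> \<Lambda>"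
      then obtain l where l: "w = concat l" "l \<in> \<Lambda>'"
        by (auto simp: \<Lambda>_def)
      with \<Lambda>'(2) have "hd l = b" "l \<noteq> []"
        using q(1) by (auto simp: B_def)
      then show "length w = N \<and> set w \<subseteq> S \<and> take (length b) w = b"
        using words_\<Lambda>[OF w] l by (cases l) (auto simp: words_def)
      have "0 < V w"
        using w by (simp add: \<Lambda>_def)
      then obtain y where y: "y \<in> cyl X (w @ b)" "0 < orbit_prod \<psi> N y"
        by (auto simp: V_def cyl_weight_def less_SUP_iff)
      fix i assume "i < N"
      with y(2) have "M (y i) (y (Suc i)) = 1"
        by (rule orbit_prod_degenerate_weight_pos_D)
      \<comment> \<open>N factors control N transitions, the last of which ends at index N, the
        first letter of \<open>b\<close>.\<close>
      moreover have "y j = (w @ b) ! j" if "j \<le> N" for j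
      proof -
        have "j < length (w @ b)"
          using that words_\<Lambda>[OF w] \<open>b \<noteq> []\<close> by (cases b) (auto simp: words_def)
        then show ?thesis
          using y(1) by (auto simp: cyl_def)
      qed
      ultimately show "M ((w @ b) ! i) ((w @ b) ! Suc i) = 1"
        using \<open>i < N\<close> by simp
    qed (use fin \<open>N \<ge> 1\<close> M_support L_pos \<open>0 < c\<close> h Y m in \<open>auto intro: less_imp_le\<close>)
    finally show ?thesis
      by (simp only: partition_fun_eq_infsum_cyl_weight)
  qed
  \<comment> \<open>The supremum over the cylinder in X is at most \<open>exp D\<close> times the
    value at any point \<open>y\<close> of X_M in it; the 2 cancels the one in
    \<open>c\<close>.\<close>
  have psi_ge: "2 * (c * L w) \<le> orbit_prod \<psi> N y" if w: "w \<in> \<Lambda>" and y: "y \<in> cyl XM (w @ b)" for w y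
  proof -
    have "V w \<le> ennreal (orbit_prod \<psi> N y / exp (- D))"
      unfolding V_def cyl_weight_def
    proof (intro SUP_least ennreal_leI)
      fix y' assume "y' \<in> cyl X (w @ b)"
      then have "exp (- D) * orbit_prod \<psi> N y' \<le> orbit_prod \<psi> N y"
        using y words_\<Lambda>[OF w] len_k[OF b] by (intro distortion_orbit_prod) (auto simp: words_def)
      then show "orbit_prod \<psi> N y' \<le> orbit_prod \<psi> N y / exp (- D)"
        by (simp add: le_divide_eq mult.commute)
    qed
    then have "L w \<le> orbit_prod \<psi> N y / exp (- D)"
      unfolding V_eq[OF w] by (simp add: orbit_prod_nonneg degenerate_weight_nonneg)
    then show ?thesis
      by (simp add: c_def le_divide_eq mult.commute)
  qed
  have cL_pos: "0 < c * L w" if "w \<in> \<Lambda>" for w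
    using \<open>0 < c\<close> L_pos[OF that] by simp
  show "ereal (r' / real k) \<le> pressure S XM \<phi>"
  proof (rule pressure_ge_if_partition_fun_ge[OF partition_fun_XM_finite \<open>N \<ge> 1\<close>], rule ge)
    fix w y assume *: "w \<in> \<Lambda>" "y \<in> cyl XM (w @ b)"
    have "c * L w \<le> orbit_prod \<psi> N y"
      using psi_ge[OF *] cL_pos[OF *(1)] by simp
    also have "\<dots> = orbit_prod (\<lambda>\<omega>. exp (\<phi> \<omega>)) N y"
      using * by (simp add: orbit_prod_exp orbit_prod_degenerate_weight_eq[of _ S0] cyl_def)
    finally show "c * L w \<le> orbit_prod (\<lambda>\<omega>. exp (\<phi> \<omega>)) N y" .
  qed auto
  \<comment> \<open>There are finitely many loops, each with a positive margin on its whole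
    cylinder, so one bound on \<epsilon> serves them all.\<close>
  have "\<forall>\<^sub>F \<epsilon> in at_right 0. \<forall>w\<in>\<Lambda>. \<forall>y\<in>cyl X (w @ b).
      dist (orbit_prod (\<lambda>\<omega>. exp (\<phi>eps \<epsilon> \<omega>)) N y) (orbit_prod \<psi> N y) < c * L w"
    using fin uniform_limit_orbit_prod_eps[OF words_\<Lambda>, of _ b] cL_pos
    by (intro eventually_ball_finite) (auto simp: uniform_limit_iff)
  then show "\<forall>\<^sub>F \<epsilon> in at_right 0. ereal (r' / real k) \<le> pressure S X (\<phi>eps \<epsilon>)"
    using eventually_eps
  proof eventually_elim
    case (elim \<epsilon>)
    show ?case
    proof (rule pressure_ge_if_partition_fun_ge[OF partition_fun_finite[OF elim(2)] \<open>N \<ge> 1\<close>], rule ge)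
      fix w y assume *: "w \<in> \<Lambda>" "y \<in> cyl XM (w @ b)"
      then have "y \<in> cyl X (w @ b)"
        using XM_subset by (auto simp: cyl_def)
      then have "dist (orbit_prod (\<lambda>\<omega>. exp (\<phi>eps \<epsilon> \<omega>)) N y) (orbit_prod \<psi> N y) < c * L w"
        using elim(1) *(1) by blast
      with psi_ge[OF *] show "c * L w \<le> orbit_prod (\<lambda>\<omega>. exp (\<phi>eps \<epsilon> \<omega>)) N y"
        by (simp add: dist_real_def)
    qed (use XM_subset in auto)
  qed
qed

section \<open>The dichotomy and the limit of the pressures\<close>

text \<open>The alternatives are decided by the loop series at \<rho> k per block. The gap is there
  because divergence at a rate yields lower bounds for smaller rates.\<close>

lemma pressure_dichotomy:
  fixes \<rho>' \<rho> :: real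
  assumes "\<rho>' < \<rho>"
  shows "(pressure S XM \<phi> \<le> ereal \<rho> \<and> (\<forall>\<^sub>F \<epsilon> in at_right 0. pressure S X (\<phi>eps \<epsilon>) \<le> ereal \<rho>)) \<or>
    (ereal \<rho>' \<le> pressure S XM \<phi> \<and> (\<forall>\<^sub>F \<epsilon> in at_right 0. ereal \<rho>' \<le> pressure S X (\<phi>eps \<epsilon>)))"
proof (cases "\<forall>b\<in>words S k. loop_sum (\<rho> * real k) b < \<infinity>")
  case True
  then show ?thesis
    using pressures_le_if_loop_sums_finite[of "\<rho> * real k"] k_pos by simp
next
  case False
  then obtain b where "b \<in> words S k" "loop_sum (\<rho> * real k) b = \<infinity>"
    by (auto simp: not_less top_unique)
  then show ?thesis
    using pressures_ge_if_loop_sum_infinite[of b "\<rho> * real k" "\<rho>' * real k"] assms k_pos by simp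
qed

text \<open>With both ends of the gap strictly on one side of the pressure of X_M, one alternative
  of the dichotomy contradicts that pressure and the other is the estimate sought. Infinite values
  are covered too.\<close>

lemma pressure_tendsto:
  "((\<lambda>\<epsilon>. pressure S X (\<phi>eps \<epsilon>)) \<longlongrightarrow> pressure S XM \<phi>) (at_right 0)"
proof (rule order_tendstoI)
  fix y assume "y < pressure S XM \<phi>"
  then obtain \<rho>' where \<rho>': "y < ereal \<rho>'" "ereal \<rho>' < pressure S XM \<phi>"
    using ereal_dense2 by blast
  then obtain \<rho> where "\<rho>' < \<rho>" "ereal \<rho> < pressure S XM \<phi>"
    using ereal_dense2[OF \<rho>'(2)] by auto
  then have "\<forall>\<^sub>F \<epsilon> in at_right 0. ereal \<rho>' \<le> pressure S X (\<phi>eps \<epsilon>)"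
    using pressure_dichotomy[of \<rho>' \<rho>] by auto
  then show "\<forall>\<^sub>F \<epsilon> in at_right 0. y < pressure S X (\<phi>eps \<epsilon>)"
    by eventually_elim (rule less_le_trans[OF \<rho>'(1)])
next
  fix y assume "pressure S XM \<phi> < y"
  then obtain \<rho> where \<rho>: "pressure S XM \<phi> < ereal \<rho>" "ereal \<rho> < y"
    using ereal_dense2 by blast
  then obtain \<rho>' where "\<rho>' < \<rho>" "pressure S XM \<phi> < ereal \<rho>'"
    using ereal_dense2[OF \<rho>(1)] by auto
  then have "\<forall>\<^sub>F \<epsilon> in at_right 0. pressure S X (\<phi>eps \<epsilon>) \<le> ereal \<rho>"
    using pressure_dichotomy[of \<rho>' \<rho>] by auto
  then show "\<forall>\<^sub>F \<epsilon> in at_right 0. pressure S X (\<phi>eps \<epsilon>) < y"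
    by eventually_elim (rule le_less_trans[OF _ \<rho>(2)])
qed

end

section \<open>From the seminorm and convergence hypotheses to the locale\<close>

lemma lip_seminorm_bound:
  assumes \<theta>: "0 < \<theta>" and fin: "lip_seminorm \<theta> X m f < \<infinity>"
  obtains C where "0 \<le> C" "\<And>n \<omega> \<upsilon>. m \<le> n \<Longrightarrow> \<omega> \<in> X \<Longrightarrow> \<upsilon> \<in> X \<Longrightarrow>
    (\<And>i. i < n \<Longrightarrow> \<omega> i = \<upsilon> i) \<Longrightarrow> \<bar>f \<omega> - f \<upsilon>\<bar> \<le> C * \<theta> ^ n"
proof
  define C where "C = enn2real (lip_seminorm \<theta> X m f)"
  show "0 \<le> C" by (simp add: C_def)
  have C: "lip_seminorm \<theta> X m f = ennreal C"
    using fin by (simp add: C_def)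
  fix n \<omega> \<upsilon> assume *: "m \<le> n" "\<omega> \<in> X" "\<upsilon> \<in> X" "\<And>i. i < n \<Longrightarrow> \<omega> i = \<upsilon> i"
  have "ennreal (\<bar>f \<omega> - f \<upsilon>\<bar> / \<theta> ^ n) = ennreal \<bar>f \<omega> - f \<upsilon>\<bar> / ennreal (\<theta> ^ n)"
    using \<theta> by (simp add: divide_ennreal)
  also have "\<dots> \<le> var X n f / ennreal (\<theta> ^ n)"
    unfolding var_def using * by (intro divide_right_mono_ennreal SUP_upper2[of "(\<omega>, \<upsilon>)"]) auto
  also have "\<dots> \<le> ennreal C"
    unfolding C[symmetric] lip_seminorm_def using * by (intro SUP_upper) auto
  finally have "\<bar>f \<omega> - f \<upsilon>\<bar> / \<theta> ^ n \<le> C"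
    using \<open>0 \<le> C\<close> by (simp add: ennreal_le_iff)
  then show "\<bar>f \<omega> - f \<upsilon>\<bar> \<le> C * \<theta> ^ n"
    using \<theta> by (simp add: divide_le_eq)
qed

text \<open>At time i < n the two orbits still agree on n + k - i \<ge> k + 1 letters, which is
  where the seminorm gives control. The errors decay geometrically towards the start of the word, so
  their sum is bounded uniformly in n.\<close>

lemma birkhoff_sum_distortion:
  assumes \<theta>: "0 < \<theta>" "\<theta> < 1"
    and f: "\<And>n \<omega> \<upsilon>. k + 1 \<le> n \<Longrightarrow> \<omega> \<in> markov_shift S A \<Longrightarrow> \<upsilon> \<in> markov_shift S A \<Longrightarrow>
      (\<And>i. i < n \<Longrightarrow> \<omega> i = \<upsilon> i) \<Longrightarrow> \<bar>f \<omega> - f \<upsilon>\<bar> \<le> C * \<theta> ^ n"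
    and "0 \<le> C" and \<omega>: "\<omega> \<in> markov_shift S A" "\<upsilon> \<in> markov_shift S A"
    and agree: "\<forall>i<n + k. \<omega> i = \<upsilon> i"
  shows "birkhoff_sum n f \<omega> \<le> birkhoff_sum n f \<upsilon> + C / (1 - \<theta>)"
proof -
  have "birkhoff_sum n f \<omega> - birkhoff_sum n f \<upsilon> = (\<Sum>i<n. f ((shift ^^ i) \<omega>) - f ((shift ^^ i) \<upsilon>))"
    by (simp add: birkhoff_sum_def sum_subtractf)
  also have "\<dots> \<le> (\<Sum>i<n. C * \<theta> ^ (n - Suc i))"
  proof (rule sum_mono)
    fix i assume i: "i \<in> {..<n}"
    have "\<bar>f ((shift ^^ i) \<omega>) - f ((shift ^^ i) \<upsilon>)\<bar> \<le> C * \<theta> ^ (n + k - i)"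
      using i agree \<omega> by (intro f shift_funpow_markov_shift) (auto simp: funpow_shift_apply)
    also have "\<dots> \<le> C * \<theta> ^ (n - Suc i)"
      using \<theta> \<open>0 \<le> C\<close> by (intro mult_left_mono power_decreasing) auto
    finally show "f ((shift ^^ i) \<omega>) - f ((shift ^^ i) \<upsilon>) \<le> C * \<theta> ^ (n - Suc i)"
      by linarith
  qed
  also have "\<dots> = C * (\<Sum>i<n. \<theta> ^ i)"
    by (simp add: sum_distrib_left[symmetric] sum.nat_diff_reindex)
  also have "\<dots> \<le> C * (1 / (1 - \<theta>))"
    using \<theta> \<open>0 \<le> C\<close> by (intro mult_left_mono) (simp_all add: sum_gp_strict divide_right_mono)
  finally show ?thesis
    by simp
qed

theorem proposition6p1:
  fixes S S0 :: "'a set"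
    and A M :: "'a \<Rightarrow> 'a \<Rightarrow> nat"
    and \<theta> :: real
    and k :: nat
    and \<phi> \<psi> :: "'a sequence \<Rightarrow> real"
    and \<phi>eps :: "real \<Rightarrow> 'a sequence \<Rightarrow> real"
    and X XM :: "'a sequence set"
  defines "X \<equiv> markov_shift S A"
    and "XM \<equiv> markov_shift S0 M"
    and "\<psi> \<equiv> (\<lambda>\<omega>. if M (\<omega> 0) (\<omega> 1) = 1 then exp (\<phi> \<omega>) else 0)"
  assumes "countable S"
    and "zero_one_matrix S A"
    and "0 < \<theta>" and "\<theta> < 1"
    and "S0 \<subseteq> S" and "S0 \<noteq> {}"
    and "zero_one_matrix S0 M"
    and "\<And>i j. i \<in> S0 \<Longrightarrow> j \<in> S0 \<Longrightarrow> M i j \<le> A i j"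
    and "\<And>i j. i \<notin> S0 \<or> j \<notin> S0 \<Longrightarrow> M i j = 0"
    and A1: "irreducible_matrix S A"
    and A2: "has_periodic_point XM"
    and "k \<ge> 1"
    and A3: "summable_potential S X \<phi>" "lip_seminorm \<theta> X (k + 1) \<phi> < \<infinity>"
    and B1: "\<And>\<epsilon>. \<epsilon> \<in> {0<..<1} \<Longrightarrow> \<phi>eps \<epsilon> \<in> F1 \<theta> X"
            "(SUP \<epsilon>\<in>{0<..<1}. lip_seminorm \<theta> X (k + 1) (\<phi>eps \<epsilon>)) < \<infinity>"
    and B2: "(\<Sum>\<^sub>\<infinity>s\<in>S. ereal_exp (SUP \<epsilon>\<in>{0<..<1}. SUP \<omega>\<in>cyl X [s]. ereal (\<phi>eps \<epsilon> \<omega>))) < \<infinity>"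
    and B3: "\<And>a. a \<in> S \<Longrightarrow>
               ((\<lambda>\<epsilon>. SUP \<omega>\<in>cyl X [a]. ennreal \<bar>exp (\<phi>eps \<epsilon> \<omega>) - \<psi> \<omega>\<bar>) \<longlongrightarrow> 0) (at_right 0)"
  shows "((\<lambda>\<epsilon>. pressure S X (\<phi>eps \<epsilon>)) \<longlongrightarrow> pressure S XM \<phi>) (at_right 0)"
proof -
  \<comment> \<open>The summand of (B.2), which dominates every perturbed weight on the cylinder of
    \<open>s\<close>.\<close>
  define a where "a s = ereal_exp (SUP \<epsilon>\<in>{0<..<1}. SUP \<omega>\<in>cyl X [s]. ereal (\<phi>eps \<epsilon> \<omega>))" for s
  have psi: "\<psi> = degenerate_weight M \<phi>"
    by (simp add: \<psi>_def degenerate_weight_def)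
  have support: "i \<in> S0 \<and> j \<in> S0" if "M i j = 1" for i j
    using that assms(12)[of i j] by auto
  have in_cyl: "\<omega> \<in> cyl X [\<omega> 0]" "\<omega> 0 \<in> S" if "\<omega> \<in> X" for \<omega>
    using that by (auto simp: cyl_def X_def markov_shift_def)
  have eps_le: "ennreal (exp (\<phi>eps \<epsilon> \<omega>)) \<le> a (\<omega> 0)" if "\<epsilon> \<in> {0<..<1}" "\<omega> \<in> X" for \<epsilon> \<omega>
  proof -
    have "ereal_exp (ereal (\<phi>eps \<epsilon> \<omega>)) \<le> a (\<omega> 0)"
      unfolding a_def using that in_cyl(1)[OF that(2)]
      by (intro ereal_exp_mono SUP_upper2[of \<epsilon>] SUP_upper) auto
    then show ?thesis
      by (simp add: ereal_exp_def)
  qed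
  have unif: "uniform_limit (cyl X [s]) (\<lambda>\<epsilon> \<omega>. exp (\<phi>eps \<epsilon> \<omega>)) \<psi> (at_right 0)" if "s \<in> S" for s
    unfolding uniform_limit_iff
  proof (intro allI impI)
    fix e :: real assume "0 < e"
    then have "\<forall>\<^sub>F \<epsilon> in at_right 0. (SUP \<omega>\<in>cyl X [s]. ennreal \<bar>exp (\<phi>eps \<epsilon> \<omega>) - \<psi> \<omega>\<bar>) < ennreal e"
      by (intro order_tendstoD(2)[OF B3[OF that]]) simp
    then show "\<forall>\<^sub>F \<epsilon> in at_right 0. \<forall>\<omega>\<in>cyl X [s]. dist (exp (\<phi>eps \<epsilon> \<omega>)) (\<psi> \<omega>) < e"
      by eventually_elim (auto dest!: SUP_lessD simp: dist_real_def ennreal_less_iff)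
  qed
  \<comment> \<open>Letting \<epsilon> tend to 0 in \<open>eps_le\<close> at the single point
    \<open>\<omega>\<close> gives the limit weight the same majorant.\<close>
  have psi_le: "ennreal (\<psi> \<omega>) \<le> a (\<omega> 0)" if "\<omega> \<in> X" for \<omega>
  proof (rule tendsto_upperbound)
    show "((\<lambda>\<epsilon>. ennreal (exp (\<phi>eps \<epsilon> \<omega>))) \<longlongrightarrow> ennreal (\<psi> \<omega>)) (at_right 0)"
      using in_cyl[OF that] by (intro tendsto_ennrealI tendsto_uniform_limitI[OF unif]) auto
    have "\<forall>\<^sub>F \<epsilon> in at_right 0. \<epsilon> \<in> {0<..<(1::real)}"
      using eventually_at_right_real[of 0 1] by simp
    then show "\<forall>\<^sub>F \<epsilon> in at_right 0. ennreal (exp (\<phi>eps \<epsilon> \<omega>)) \<le> a (\<omega> 0)"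
      by eventually_elim (rule eps_le[OF _ that])
  qed simp
  obtain C where C: "0 \<le> C" "\<And>n \<omega> \<upsilon>. k + 1 \<le> n \<Longrightarrow> \<omega> \<in> X \<Longrightarrow> \<upsilon> \<in> X \<Longrightarrow>
      (\<And>i. i < n \<Longrightarrow> \<omega> i = \<upsilon> i) \<Longrightarrow> \<bar>\<phi> \<omega> - \<phi> \<upsilon>\<bar> \<le> C * \<theta> ^ n"
    using lip_seminorm_bound[OF \<open>0 < \<theta>\<close> A3(2)] by blast
  interpret degenerating_potential S S0 A M k \<phi> \<phi>eps a "C / (1 - \<theta>)"
  proof
    show "markov_shift S0 M \<subseteq> markov_shift S A"
    proof
      fix \<omega> assume \<omega>: "\<omega> \<in> markov_shift S0 M"
      \<comment> \<open>The entries of A are 0 or 1, so the lower bound by M forces the value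
        1.\<close>
      have "A (\<omega> n) (\<omega> (Suc n)) = 1" for n
      proof -
        have n: "\<omega> n \<in> S0" "\<omega> (Suc n) \<in> S0" "M (\<omega> n) (\<omega> (Suc n)) = 1"
          using \<omega> by (auto simp: markov_shift_def)
        then have "1 \<le> A (\<omega> n) (\<omega> (Suc n))"
          using assms(11)[OF n(1,2)] by simp
        moreover have "A (\<omega> n) (\<omega> (Suc n)) \<in> {0, 1}"
          using n \<open>S0 \<subseteq> S\<close> \<open>zero_one_matrix S A\<close> unfolding zero_one_matrix_def by blast
        ultimately show ?thesis by auto
      qed
      then show "\<omega> \<in> markov_shift S A"
        using \<omega> \<open>S0 \<subseteq> S\<close> by (auto simp: markov_shift_def)
    qed
    show "infsum a S < \<infinity>"
      using B2 by (simp add: a_def[abs_def])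
    show "birkhoff_sum n \<phi> \<omega> \<le> birkhoff_sum n \<phi> \<upsilon> + C / (1 - \<theta>)"
      if "\<omega> \<in> markov_shift S A" "\<upsilon> \<in> markov_shift S A" "\<forall>i<n + k. \<omega> i = \<upsilon> i" for n \<omega> \<upsilon>
      using birkhoff_sum_distortion[OF \<open>0 < \<theta>\<close> \<open>\<theta> < 1\<close> C(2)[unfolded X_def] C(1) that] .
  qed (use \<open>k \<ge> 1\<close> support eps_le psi_le unif in \<open>auto simp: X_def psi\<close>)
  show ?thesis
    using pressure_tendsto by (simp add: X_def XM_def)
qed

end
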